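(* Let \[ F_\circ(t,u,x) = \sum_{n\ge 1} t^n \sum_{[R,S]} u^{\mathrm{ds}(S)}\, x^{\mathrm{cont}(R)-1}, \] where the inner sum is over all synchronized intervals $[R,S]$ of Dyck paths of length $2n$ avoiding $NNN$ (that is, pairs $R\leq_D S$ in $\mathcal{D}_{2n}$, both avoiding $NNN$, with $\mathrm{Type}(R)=\mathrm{Type}(S)$). Then $F_\circ(t,u,x)$ is an algebraic series in $t,u,x$ (i.e. algebraic over $\mathbb{Q}(t,u,x)$).
   Context: A Dyck path is a non-empty lattice path in $\mathbb{Z}^2$ starting at $(0,0)$, ending on the diagonal $y=x$, staying weakly above the diagonal, with steps $N=(0,1)$ and $E=(1,0)$. Its length is its number of steps; $\mathcal{D}_{2n}$ is the set of Dyck paths of length $2n$. A path avoids $NNN$ if it has no three consecutive $N$ steps. Tamari order: a valley of a Dyck path $R$ is a lattice point $v$ on $R$ preceded by $E$ and followed by $N$. Given a valley $v$, let $w$ be the next lattice point on $R$ after $v$ with the same horizontal distance to the diagonal (the horizontal distance of $(a,b)$ is $b-a$). Exchanging the sub-path between $v$ and $w$ with the $E$ step just before $v$ gives a Dyck path covering $R$; $\leq_D$ is the reflexive transitive closure of this covering relation on $\mathcal{D}_{2n}$. For $R\in\mathcal{D}_{2n}$, $\mathrm{Type}(R)$ is the word $w$ of length $n-1$ with $w_i=N$ if the $i$-th north step of $R$ is immediately followed by an east step, and $w_i=E$ otherwise. $\mathrm{cont}(R)$ is the number of contacts of $R$, i.e. of lattice points of $R$ on the diagonal $x=y$ (including both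 end points). For $S$ avoiding $NNN$, written $S=N^{a_1}E^{b_1}\cdots N^{a_k}E^{b_k}$ with $a_i\in\{1,2\}$, $b_i\ge1$, $\mathrm{ds}(S)$ is the number of indices $i$ with $a_i=1$. *)

theory Defs
  imports
    "HOL-Computational_Algebra.Computational_Algebra"
    "HOL-Library.Sublist"
begin

section \<open>Dyck paths\<close>

datatype step = N | E

type_synonym path = "step list"

text \<open>The lattice point \<open>(a, b)\<close> reached from the origin after the first \<open>i\<close> steps.\<close>

definition point :: "path \<Rightarrow> nat \<Rightarrow> int \<times> int" where
  "point R i = (int (count_list (take i R) E), int (count_list (take i R) N))"

definition hdist :: "int \<times> int \<Rightarrow> int" where
  "hdist p = snd p - fst p"

definition dyck :: "path \<Rightarrow> bool" where
  "dyck R \<longleftrightarrow> R \<noteq> [] \<and>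
     (\<forall>i\<le>length R. fst (point R i) \<le> snd (point R i)) \<and>
     fst (point R (length R)) = snd (point R (length R))"

definition dyck_paths :: "nat \<Rightarrow> path set" where
  "dyck_paths m = {R. dyck R \<and> length R = m}"

definition avoids_NNN :: "path \<Rightarrow> bool" where
  "avoids_NNN R \<longleftrightarrow> \<not> sublist [N, N, N] R"


section \<open>Tamari order\<close>

text \<open>Points of a path are referred to by the number \<open>i\<close> of steps preceding them.\<close>

definition valley :: "path \<Rightarrow> nat \<Rightarrow> bool" where
  "valley R i \<longleftrightarrow> 0 < i \<and> i < length R \<and> R ! (i - 1) = E \<and> R ! i = N"

definition next_same_hdist :: "path \<Rightarrow> nat \<Rightarrow> nat \<Rightarrow> bool" where
  "next_same_hdist R i j \<longleftrightarrow> i < j \<and> j \<le> length R \<and>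
     hdist (point R j) = hdist (point R i) \<and>
     (\<forall>k. i < k \<and> k < j \<longrightarrow> hdist (point R k) \<noteq> hdist (point R i))"

definition tamari_cover :: "path \<Rightarrow> path \<Rightarrow> bool" where
  "tamari_cover R R' \<longleftrightarrow> (\<exists>i j. valley R i \<and> next_same_hdist R i j \<and>
     R' = take (i - 1) R @ take (j - i) (drop i R) @ [E] @ drop j R)"

definition tamari_le :: "nat \<Rightarrow> path \<Rightarrow> path \<Rightarrow> bool" where
  "tamari_le m R S \<longleftrightarrow> R \<in> dyck_paths m \<and> S \<in> dyck_paths m \<and>
     (\<lambda>P Q. P \<in> dyck_paths m \<and> Q \<in> dyck_paths m \<and> tamari_cover P Q)\<^sup>*\<^sup>* R S"


section \<open>Statistics\<close>

definition north_indices :: "path \<Rightarrow> nat list" where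
  "north_indices R = filter (\<lambda>k. R ! k = N) [0..<length R]"

text \<open>The entry at index \<open>i\<close> (from \<open>0\<close>) is the letter \<open>w\<^sub>i\<^sub>+\<^sub>1\<close> of the type.\<close>

definition path_type :: "path \<Rightarrow> step list" where
  "path_type R = map (\<lambda>i. if R ! Suc (north_indices R ! i) = E then N else E)
     [0..<length R div 2 - 1]"

definition cont :: "path \<Rightarrow> nat" where
  "cont R = card {p \<in> point R ` {0..length R}. fst p = snd p}"

definition block_word :: "(nat \<times> nat) list \<Rightarrow> path" where
  "block_word bs = concat (map (\<lambda>(a, b). replicate a N @ replicate b E) bs)"

definition block_decomposition :: "path \<Rightarrow> (nat \<times> nat) list \<Rightarrow> bool" where
  "block_decomposition S bs \<longleftrightarrow>
     S = block_word bs \<and> (\<forall>(a, b) \<in> set bs. a \<in> {1, 2} \<and> b \<ge> 1)"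

definition ds :: "path \<Rightarrow> nat" where
  "ds S = length (filter (\<lambda>(a, b). a = 1) (THE bs. block_decomposition S bs))"

text \<open>The description in \<^const>\<open>ds\<close> is well-defined for Dyck paths avoiding \<open>NNN\<close>.\<close>

lemma replicate_append_eq:
  assumes "replicate a x @ u = replicate a' x @ u'"
    and "u = [] \<or> hd u \<noteq> x" "u' = [] \<or> hd u' \<noteq> x"
  shows "a = a' \<and> u = u'"
  using assms
proof (induction a arbitrary: a')
  case 0
  then show ?case by (cases a') auto
next
  case (Suc a)
  then show ?case by (cases a') auto
qed

lemma block_decomposition_unique:
  assumes "block_decomposition S bs" "block_decomposition S bs'"
  shows "bs = bs'"
  using assms
proof (induction bs arbitrary: S bs')
  case Nil
  then show ?case
    by (cases bs') (auto simp: block_decomposition_def block_word_def)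
next
  case (Cons p bs)
  obtain a b where p: "p = (a, b)" by force
  from Cons.prems obtain p' bs'' where bs': "bs' = p' # bs''"
    by (cases bs') (auto simp: block_decomposition_def block_word_def p)
  obtain a' b' where p': "p' = (a', b')" by force
  have pos: "b \<ge> 1" "b' \<ge> 1"
    using Cons.prems by (auto simp: block_decomposition_def p p' bs')
  have hd_N: "block_word xs = [] \<or> hd (block_word xs) \<noteq> E"
    if "block_decomposition T xs" for T xs
    using that by (cases xs) (auto simp: block_decomposition_def block_word_def hd_append)
  have bd: "block_decomposition (block_word bs) bs"
      "block_decomposition (block_word bs'') bs''"
    using Cons.prems by (auto simp: block_decomposition_def bs')
  have "replicate a N @ replicate b E @ block_word bs
      = replicate a' N @ replicate b' E @ block_word bs''"
    using Cons.prems by (simp add: block_decomposition_def block_word_def p p' bs')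
  then have "a = a' \<and> replicate b E @ block_word bs = replicate b' E @ block_word bs''"
    by (rule replicate_append_eq) (use pos in \<open>auto simp: hd_append\<close>)
  moreover from this have "b = b' \<and> block_word bs = block_word bs''"
    by (intro replicate_append_eq) (use hd_N bd in auto)
  ultimately show ?case
    using Cons.IH[OF bd(1)] bd(2) by (simp add: p p' bs')
qed

lemma block_decomposition_exists_aux:
  assumes "w = [] \<or> hd w = N \<and> last w = E" "avoids_NNN w"
  shows "\<exists>bs. block_decomposition w bs"
  using assms
proof (induction "length w" arbitrary: w rule: less_induct)
  case less
  show ?case
  proof (cases "w = []")
    case True
    then show ?thesis
      by (intro exI[of _ "[]"]) (simp add: block_decomposition_def block_word_def)
  next
    case False
    with less.prems have hd: "hd w = N" and last: "last w = E" by auto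
    define u where "u = dropWhile (\<lambda>s. s = N) w"
    define v where "v = dropWhile (\<lambda>s. s = E) u"
    define a where "a = length (takeWhile (\<lambda>s. s = N) w)"
    define b where "b = length (takeWhile (\<lambda>s. s = E) u)"
    have ra: "takeWhile (\<lambda>s. s = N) w = replicate a N"
      unfolding a_def by (rule replicate_eqI) (auto dest: set_takeWhileD)
    have rb: "takeWhile (\<lambda>s. s = E) u = replicate b E"
      unfolding b_def by (rule replicate_eqI) (auto dest: set_takeWhileD)
    have w: "w = replicate a N @ u" using ra takeWhile_dropWhile_id u_def by metis
    have u: "u = replicate b E @ v" using rb takeWhile_dropWhile_id v_def by metis
    have "u \<noteq> []" using last False last_in_set[of w] by (force simp: u_def dropWhile_eq_Nil_conv)
    then have "hd u = E" using hd_dropWhile[of "\<lambda>s. s = N" w] step.exhaust[of "hd u"] by (auto simp: u_def)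
    then have b: "b \<ge> 1" using \<open>u \<noteq> []\<close> by (cases u) (auto simp: b_def)
    have a1: "a \<ge> 1" using hd False by (cases w) (auto simp: a_def)
    have a2: "a \<le> 2"
    proof (rule ccontr)
      assume "\<not> a \<le> 2"
      then have "a = 3 + (a - 3)" by simp
      then have "replicate a N = [N, N, N] @ replicate (a - 3) N"
        by (metis replicate_add replicate_0 replicate_Suc numeral_3_eq_3)
      then have "w = [] @ [N, N, N] @ (replicate (a - 3) N @ u)" using w by simp
      then show False using less.prems(2) unfolding avoids_NNN_def sublist_def by blast
    qed
    have "v = [] \<or> hd v = N \<and> last v = E"
    proof (cases "v = []")
      case False
      then have "hd v \<noteq> E" using hd_dropWhile[of "\<lambda>s. s = E" u] by (auto simp: v_def)
      then have "hd v = N" using step.exhaust by blast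
      moreover have "last v = E" using last False w u by simp
      ultimately show ?thesis by simp
    qed simp
    moreover have "avoids_NNN v"
      unfolding avoids_NNN_def
    proof
      assume "sublist [N, N, N] v"
      moreover have "w = (replicate a N @ replicate b E) @ v @ []" using w u by simp
      ultimately show False using less.prems(2)
        unfolding avoids_NNN_def by (metis sublist_appendI sublist_order.order_trans)
    qed
    moreover have "length v < length w" using a1 by (simp add: w u)
    ultimately obtain bs where "block_decomposition v bs" using less.hyps by blast
    then have "block_decomposition w ((a, b) # bs)"
      using a1 a2 b by (auto simp: block_decomposition_def block_word_def w u)
    then show ?thesis by blast
  qed
qed

lemma block_decomposition_ex1:
  assumes "dyck S" "avoids_NNN S"
  shows "\<exists>!bs. block_decomposition S bs"
proof -
  have ne: "S \<noteq> []" using assms(1) by (simp add: dyck_def)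
  have "hd S = N"
  proof (rule ccontr)
    assume "hd S \<noteq> N"
    then obtain T where S: "S = E # T" using ne step.exhaust by (metis list.collapse)
    have "fst (point S 1) \<le> snd (point S 1)" using assms(1) by (simp add: dyck_def S)
    then show False by (simp add: point_def S)
  qed
  moreover have "last S = E"
  proof (rule ccontr)
    assume "last S \<noteq> E"
    then obtain T where S: "S = T @ [N]"
      using ne step.exhaust by (metis append_butlast_last_id)
    have "fst (point S (length T)) \<le> snd (point S (length T))"
      "fst (point S (length S)) = snd (point S (length S))"
      using assms(1) by (simp_all add: dyck_def S)
    then show False by (simp add: point_def S)
  qed
  ultimately show ?thesis
    using block_decomposition_exists_aux[of S] assms(2) block_decomposition_unique by blast
qed


section \<open>The generating function\<close>

definition sync_intervals :: "nat \<Rightarrow> (path \<times> path) set" where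
  "sync_intervals n = {(R, S). tamari_le (2 * n) R S \<and> avoids_NNN R \<and> avoids_NNN S \<and>
     path_type R = path_type S}"

lemma finite_sync_intervals: "finite (sync_intervals n)"
proof -
  have "finite {R :: path. set R \<subseteq> {N, E} \<and> length R = 2 * n}"
    by (rule finite_lists_length_eq) simp
  moreover have "dyck_paths (2 * n) \<subseteq> {R. set R \<subseteq> {N, E} \<and> length R = 2 * n}"
    using step.exhaust by (auto simp: dyck_paths_def)
  ultimately have "finite (dyck_paths (2 * n))" by (rule rev_finite_subset)
  then have "finite (dyck_paths (2 * n) \<times> dyck_paths (2 * n))" by simp
  then show ?thesis
    by (rule rev_finite_subset) (auto simp: sync_intervals_def tamari_le_def)
qed

text \<open>
  The series lives in $\mathbb{Q}[x][u][[t]]$, represented by \<^typ>\<open>rat poly poly fps\<close>: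
  the inner polynomial variable is $x$, the outer one is $u$.
\<close>

definition var_u :: "rat poly poly" where
  "var_u = [:0, 1:]"

definition var_x :: "rat poly poly" where
  "var_x = [:[:0, 1:]:]"

definition F_circ :: "rat poly poly fps" where
  "F_circ = Abs_fps (\<lambda>n. if n \<ge> 1
     then (\<Sum>(R, S) \<in> sync_intervals n. var_u ^ ds S * var_x ^ (cont R - 1)) else 0)"


section \<open>Algebraicity\<close>

definition algebraic_over :: "'a :: field set \<Rightarrow> 'a \<Rightarrow> bool" where
  "algebraic_over K z \<longleftrightarrow> (\<exists>P. P \<noteq> 0 \<and> (\<forall>i. coeff P i \<in> K) \<and> poly P z = 0)"

text \<open>
  The field $\mathbb{Q}(t,u,x)$ as a subfield of the fraction field of $\mathbb{Q}[x][u][[t]]$;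
  elements of $\mathbb{Q}[t,u,x]$ are of type \<^typ>\<open>rat poly poly poly\<close>, with $t$ outermost.
\<close>

definition rational_functions :: "rat poly poly fps fract set" where
  "rational_functions = {Fract (fps_of_poly p) (fps_of_poly q) | p q. q \<noteq> 0}"

end

(*
  Dyck words are encoded by binary trees via the first return decomposition N A E C, so that the
  Tamari covers become tree rotations. If S = N Q1 E Q2, then R <= S holds iff
  R = N P1 E P2 P3 with P1 P2 <= Q1 and P3 <= Q2. Under equality of types P1 is empty iff Q1 is,
  and the absence of NNN leaves only Q1 empty or Q1 starting with N E. Summing over the splittings
  of P1 P2 gives, for W = 1 + F_circ and W1 = W|x=1,
    (x - 1) (W - 1) = t x W (u (x - 1) + t (x W - W1)).
  The quadratic method determines W1: let Y = t (1 + u Y) (1 + Y^2)^2; the discriminant in W has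
  a double root at x = 1 + Y^2, which forces t W1 = Y (1 - Y^2 - u Y^3). Hence t W1 is a root of a
  quintic over Q(t, u), and substituting for t W1 the rational function of W given by the
  functional equation yields a polynomial equation for W.
*)
theory Submission
  imports Defs
begin

section \<open>The Tamari order on binary trees\<close>

text \<open>At x = 1 the functional equation collapses to 0 = 0, so W1 must be found through another
  substitution for x. As a quadratic in W the equation has discriminant B^2 - 4 t^2 x^2 (x - 1),
  where B, the coefficient of W, contains W1; putting x = 1 + Y^2 factors it into (B - 2 t x Y)(B +
  2 t x Y). The choice B = -2 t x Y, together with the vanishing of the x-derivative of the
  discriminant, gives two equations linear in W1. Eliminating W1 leaves Y = t (1 + u Y)(1 + Y^2)^2,
  and the first of them then yields t W1. The proof runs backwards: Y is constructed first, and the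
  value of W1 so predicted is verified. The last step needs no closure of algebraic elements under
  field operations, but the polynomial that it produces must be shown to be nonzero; this is seen at
  W = 0.\<close>

datatype dtree = Lf | Nd dtree dtree

primrec word :: "dtree \<Rightarrow> path" where
  "word Lf = []"
| "word (Nd a c) = N # word a @ E # word c"

primrec app :: "dtree \<Rightarrow> dtree \<Rightarrow> dtree" where
  "app Lf c = c"
| "app (Nd a b) c = Nd a (app b c)"

lemma app_Lf [simp]: "app a Lf = a"
  by (induction a) auto

lemma app_assoc [simp]: "app (app a b) c = app a (app b c)"
  by (induction a) auto

lemma word_app [simp]: "word (app a b) = word a @ word b"
  by (induction a) auto

lemma size_app [simp]: "size (app a b) = size a + size b"
  by (induction a) auto

lemma length_word [simp]: "length (word a) = 2 * size a"
  by (induction a) auto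

lemma app_eq_app_size:
  assumes "app a b = app a' b'" "size a = size a'"
  shows "a = a' \<and> b = b'"
  using assms
proof (induction a arbitrary: a')
  case Lf
  then show ?case by (cases a') auto
next
  case (Nd a1 a2)
  then show ?case by (cases a') auto
qed

inductive tree_cov :: "dtree \<Rightarrow> dtree \<Rightarrow> bool" where
  rotate: "tree_cov (Nd a (Nd b c)) (Nd (app a (Nd b Lf)) c)"
| left: "tree_cov a a' \<Longrightarrow> tree_cov (Nd a c) (Nd a' c)"
| right: "tree_cov c c' \<Longrightarrow> tree_cov (Nd a c) (Nd a c')"

lemma tree_cov_size: "tree_cov r r' \<Longrightarrow> size r' = size r"
  by (induction rule: tree_cov.induct) auto

lemma tree_cov_app_left: "tree_cov a a' \<Longrightarrow> tree_cov (app a c) (app a' c)"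
  by (induction rule: tree_cov.induct) (auto intro: tree_cov.intros)

lemma tree_cov_app_right: "tree_cov c c' \<Longrightarrow> tree_cov (app a c) (app a c')"
  by (induction a) (auto intro: tree_cov.intros)

inductive_cases tree_cov_LfE: "tree_cov r Lf"

text \<open>Rotations raise the path, so the contact between \<open>x\<close> and \<open>y\<close>
  is already a contact before the rotation. Hence \<open>c\<close> splits at the same place and the
  cover acts on one of the two parts.\<close>

lemma tree_cov_into_app:
  assumes "tree_cov c (app x y)"
  shows "(\<exists>x'. tree_cov x' x \<and> c = app x' y) \<or> (\<exists>y'. tree_cov y' y \<and> c = app x y')"
  using assms
proof (induction x arbitrary: c)
  case Lf
  then show ?case by auto
next
  case (Nd a b)
  from Nd.prems have "tree_cov c (Nd a (app b y))" by simp
  then show ?case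
  proof (cases rule: tree_cov.cases)
    case (rotate a' b')
    then have "tree_cov (Nd a' (Nd b' b)) (Nd a b)" by (auto intro: tree_cov.rotate)
    then show ?thesis using rotate by fastforce
  next
    case (left a0)
    then have "tree_cov (Nd a0 b) (Nd a b)" by (auto intro: tree_cov.left)
    then show ?thesis using left by fastforce
  next
    case (right c0)
    from Nd.IH(2)[OF right(2)] right(1) show ?thesis
      by (metis app.simps(2) tree_cov.right)
  qed
qed

text \<open>In the rule \<open>Nd\<close>, \<open>pr\<close> consists of the components that
  rotations at the root move under the first N.\<close>

inductive tree_tam :: "dtree \<Rightarrow> dtree \<Rightarrow> bool" where
  Lf: "tree_tam Lf Lf"
| Nd: "tree_tam (app pl pr) q1 \<Longrightarrow> tree_tam p2 q2 \<Longrightarrow> tree_tam (Nd pl (app pr p2)) (Nd q1 q2)"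

lemma tree_tam_refl: "tree_tam a a"
proof (induction a)
  case (Nd a c)
  then show ?case using tree_tam.Nd[of a Lf a c c] by simp
qed (rule tree_tam.Lf)

lemma tree_tam_size: "tree_tam r s \<Longrightarrow> size r = size s"
  by (induction rule: tree_tam.induct) auto

text \<open>A rotation at the root of \<open>r\<close> only moves the cut between \<open>pl\<close>
  and \<open>pr\<close> and preserves their concatenation; every other cover happens inside
  \<open>pl\<close>, \<open>pr\<close> or \<open>p2\<close> and is absorbed by an induction
  hypothesis.\<close>

lemma tree_cov_tree_tam:
  assumes "tree_tam r' s" "tree_cov r r'"
  shows "tree_tam r s"
  using assms
proof (induction arbitrary: r rule: tree_tam.induct)
  case Lf
  then show ?case by (auto elim: tree_cov_LfE)
next
  case (Nd pl pr q1 p2 q2)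
  from Nd.prems show ?case
  proof (cases rule: tree_cov.cases)
    case (rotate a b)
    have "tree_tam (app a (Nd b pr)) q1" using Nd.hyps(1) rotate by simp
    from tree_tam.Nd[OF this Nd.hyps(2)] show ?thesis using rotate by simp
  next
    case (left a0)
    from tree_tam.Nd[OF Nd.IH(1)[OF tree_cov_app_left[OF left(2)]] Nd.hyps(2)] left
    show ?thesis by simp
  next
    case (right c0)
    from tree_cov_into_app[OF right(2)] show ?thesis
    proof (elim disjE exE conjE)
      fix x' assume "tree_cov x' pr" "c0 = app x' p2"
      then show ?thesis
        using tree_tam.Nd[OF Nd.IH(1)[OF tree_cov_app_right] Nd.hyps(2)] right by simp
    next
      fix y' assume "tree_cov y' p2" "c0 = app pr y'"
      then show ?thesis
        using tree_tam.Nd[OF Nd.hyps(1) Nd.IH(2)] right by simp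
    qed
  qed
qed

lemma tree_cov_rtranclp_left: "tree_cov\<^sup>*\<^sup>* a a' \<Longrightarrow> tree_cov\<^sup>*\<^sup>* (Nd a c) (Nd a' c)"
  by (induction rule: rtranclp_induct) (auto intro: rtranclp.rtrancl_into_rtrancl tree_cov.left)

lemma tree_cov_rtranclp_right: "tree_cov\<^sup>*\<^sup>* c c' \<Longrightarrow> tree_cov\<^sup>*\<^sup>* (Nd a c) (Nd a c')"
  by (induction rule: rtranclp_induct) (auto intro: rtranclp.rtrancl_into_rtrancl tree_cov.right)

text \<open>The chain has one rotation at the root for each component of \<open>b\<close>.\<close>

lemma tree_cov_rtranclp_rotate: "tree_cov\<^sup>*\<^sup>* (Nd a (app b c)) (Nd (app a b) c)"
proof (induction b arbitrary: a)
  case (Nd b1 b2)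
  have "tree_cov (Nd a (app (Nd b1 b2) c)) (Nd (app a (Nd b1 Lf)) (app b2 c))"
    by (simp add: tree_cov.rotate)
  also have "tree_cov\<^sup>*\<^sup>* \<dots> (Nd (app (app a (Nd b1 Lf)) b2) c)" by (rule Nd.IH)
  finally (converse_rtranclp_into_rtranclp) show ?case by simp
qed simp

lemma tree_tam_iff_tree_cov_rtranclp: "tree_tam r s \<longleftrightarrow> tree_cov\<^sup>*\<^sup>* r s"
proof
  assume "tree_tam r s"
  then show "tree_cov\<^sup>*\<^sup>* r s"
  proof (induction rule: tree_tam.induct)
    case (Nd pl pr q1 p2 q2)
    have "tree_cov\<^sup>*\<^sup>* (Nd pl (app pr p2)) (Nd (app pl pr) p2)" by (rule tree_cov_rtranclp_rotate)
    also have "tree_cov\<^sup>*\<^sup>* \<dots> (Nd q1 p2)" by (rule tree_cov_rtranclp_left) (rule Nd.IH)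
    also have "tree_cov\<^sup>*\<^sup>* \<dots> (Nd q1 q2)" by (rule tree_cov_rtranclp_right) (rule Nd.IH)
    finally show ?case .
  qed simp
next
  assume "tree_cov\<^sup>*\<^sup>* r s"
  then show "tree_tam r s"
    by (induction rule: converse_rtranclp_induct) (auto intro: tree_tam_refl tree_cov_tree_tam)
qed

section \<open>Types, avoidance of NNN and synchronized pairs of trees\<close>

primrec tree_type :: "dtree \<Rightarrow> bool list" where
  "tree_type Lf = []"
| "tree_type (Nd a c) = (a = Lf) # tree_type a @ tree_type c"

lemma length_tree_type [simp]: "length (tree_type a) = size a"
  by (induction a) auto

lemma tree_type_app [simp]: "tree_type (app a b) = tree_type a @ tree_type b"
  by (induction a) auto

lemma tree_type_eq_Nil [simp]: "tree_type a = [] \<longleftrightarrow> a = Lf" "[] = tree_type a \<longleftrightarrow> a = Lf"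
  by (cases a; simp)+

text \<open>Only an initial NN is excluded, not NN in general: imposed on the left subtree of a
  node, this prevents the N of that node from starting an NNN.\<close>

primrec avoids_NN :: "dtree \<Rightarrow> bool" where
  "avoids_NN Lf \<longleftrightarrow> True"
| "avoids_NN (Nd a c) \<longleftrightarrow> a = Lf"

primrec tree_avoids :: "dtree \<Rightarrow> bool" where
  "tree_avoids Lf \<longleftrightarrow> True"
| "tree_avoids (Nd a c) \<longleftrightarrow> avoids_NN a \<and> tree_avoids a \<and> tree_avoids c"

lemma tree_avoids_app [simp]: "tree_avoids (app a b) \<longleftrightarrow> tree_avoids a \<and> tree_avoids b"
  by (induction a) auto

text \<open>
  Pairs of trees of synchronized intervals avoiding \<open>NNN\<close>: in the rule \<open>double\<close> the lower path is
  \<open>N (NE pl) E pr p\<close> and the upper one is \<open>N (NE c) E q\<close>.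
\<close>

inductive sync_pair :: "dtree \<Rightarrow> dtree \<Rightarrow> bool" where
  Lf: "sync_pair Lf Lf"
| single: "sync_pair p q \<Longrightarrow> sync_pair (Nd Lf p) (Nd Lf q)"
| double: "sync_pair (app pl pr) c \<Longrightarrow> sync_pair p q \<Longrightarrow> sync_pair (Nd (Nd Lf pl) (app pr p)) (Nd (Nd Lf c) q)"

lemma tree_tam_LfD: "tree_tam r Lf \<Longrightarrow> r = Lf" "tree_tam Lf r \<Longrightarrow> r = Lf"
  by (auto elim: tree_tam.cases)

lemma tree_tam_Nd_Lf_iff: "tree_tam (Nd Lf p) (Nd Lf q) \<longleftrightarrow> tree_tam p q"
proof
  assume "tree_tam (Nd Lf p) (Nd Lf q)"
  then show "tree_tam p q"
    by (cases rule: tree_tam.cases) (auto dest: tree_tam_LfD)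
next
  assume "tree_tam p q"
  then show "tree_tam (Nd Lf p) (Nd Lf q)" using tree_tam.Nd[of Lf Lf Lf p q] by (simp add: tree_tam.Lf)
qed

lemma sync_pair_imp_tree_tam: "sync_pair r s \<Longrightarrow> tree_tam r s \<and> tree_type r = tree_type s \<and> tree_avoids r \<and> tree_avoids s"
proof (induction rule: sync_pair.induct)
  case (double pl pr c p q)
  then have "tree_tam (app (Nd Lf pl) pr) (Nd Lf c)" by (simp add: tree_tam_Nd_Lf_iff)
  from tree_tam.Nd[OF this] double show ?case by auto
qed (auto simp: tree_tam_Nd_Lf_iff tree_tam.Lf)

text \<open>The induction is on the size because the recursive call concerns
  \<open>app pl' pr\<close>, which is no subtree of \<open>r\<close>. The first letters of the types
  agree, so \<open>pl\<close> is empty exactly if \<open>q1\<close> is; this selects the rule of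
  \<open>sync_pair\<close>.\<close>

lemma tree_tam_imp_sync_pair: "tree_tam r s \<Longrightarrow> tree_type r = tree_type s \<Longrightarrow> tree_avoids r \<Longrightarrow> tree_avoids s \<Longrightarrow> sync_pair r s"
proof (induction "size r" arbitrary: r s rule: less_induct)
  case less
  from less.prems(1) show ?case
  proof (cases rule: tree_tam.cases)
    case Lf
    then show ?thesis by (simp add: sync_pair.Lf)
  next
    case (Nd pl pr q1 p2 q2)
    \<comment> \<open>The sizes, here as lengths of lists, tell where to cut the equation between
      the concatenated types.\<close>
    have sz: "size (tree_type pl @ tree_type pr) = size (tree_type q1)" "size p2 = size q2"
      using tree_tam_size[OF Nd(3)] tree_tam_size[OF Nd(4)] by auto
    have tys: "pl = Lf \<longleftrightarrow> q1 = Lf" "tree_type pl @ tree_type pr = tree_type q1" "tree_type p2 = tree_type q2"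
      using less.prems(2) sz unfolding Nd by (auto simp flip: append_assoc)
    have J2: "sync_pair p2 q2"
      using less.prems tys Nd by (intro less.hyps) auto
    show ?thesis
    proof (cases q1)
      case Lf
      then show ?thesis using J2 tys sz Nd by (auto intro: sync_pair.single)
    next
      case q1: (Nd a c)
      note [simp] = q1
      \<comment> \<open>Avoidance of NNN makes \<open>q1\<close>, and likewise \<open>pl\<close>,
        begin with NE; removing this common prefix gives the smaller pair.\<close>
      have [simp]: "a = Lf" using less.prems(4) Nd(2) by simp
      obtain pl' where [simp]: "pl = Nd Lf pl'"
        using tys(1) less.prems(3) Nd(1) by (cases pl) auto
      have "sync_pair (app pl' pr) c"
        using less.prems tys Nd
        by (intro less.hyps) (auto simp: tree_tam_Nd_Lf_iff)
      then show ?thesis using J2 Nd by (auto intro: sync_pair.double)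
    qed
  qed
qed


lemma sync_pair_iff: "sync_pair r s \<longleftrightarrow> tree_tam r s \<and> tree_type r = tree_type s \<and> tree_avoids r \<and> tree_avoids s"
  using sync_pair_imp_tree_tam tree_tam_imp_sync_pair by blast

section \<open>Dyck words of trees\<close>

primrec height :: "path \<Rightarrow> int" where
  "height [] = 0"
| "height (s # w) = (if s = N then 1 else -1) + height w"

lemma height_append [simp]: "height (v @ w) = height v + height w"
  by (induction v) auto

lemma hdist_point: "hdist (point R i) = height (take i R)"
proof -
  have "int (count_list w N) - int (count_list w E) = height w" for w
  proof (induction w)
    case (Cons s w)
    then show ?case by (cases s) auto
  qed simp
  then show ?thesis by (simp add: hdist_def point_def)
qed

lemma height_word [simp]: "height (word a) = 0"
  by (induction a) auto

lemma height_take_word: "0 \<le> height (take i (word a))"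
proof (induction a arbitrary: i)
  case (Nd a c)
  show ?case
  proof (cases i)
    case (Suc j)
    show ?thesis
    proof (cases "j - 2 * size a")
      case 0
      then show ?thesis using Nd.IH(1)[of j] Suc by simp
    next
      case (Suc k)
      then show ?thesis using Nd.IH(2)[of k] \<open>i = Suc j\<close> by simp
    qed
  qed simp
qed simp

lemma height_prefix_word: "word a = x @ y \<Longrightarrow> 0 \<le> height x"
  using height_take_word[of "length x" a] by simp

text \<open>The words \<open>word a @ [E]\<close> form a prefix code: their last step is the first
  one that brings the height below 0.\<close>

lemma word_append_E_eq_iff: "word a @ E # x = word b @ E # y \<longleftrightarrow> a = b \<and> x = y"
proof (induction a arbitrary: b x y)
  case Lf
  then show ?case by (cases b) auto
next
  case (Nd a1 a2)
  then show ?case by (cases b) auto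
qed

lemma word_inject [simp]: "word a = word b \<longleftrightarrow> a = b"
  using word_append_E_eq_iff[of a "[]" b "[]"] by auto

text \<open>Cutting just before the first descent below height 0 leaves the word of a tree. If the
  first step is N, the rest ends at height at most -2 and is parsed twice, once for each
  subtree.\<close>

lemma negative_height_parse:
  assumes "height w < 0"
  shows "\<exists>a y. w = word a @ E # y"
  using assms
proof (induction "length w" arbitrary: w rule: less_induct)
  case less
  then obtain s v where w: "w = s # v" by (cases w) auto
  show ?case
  proof (cases s)
    case N
    then have "height v < 0" using less.prems w by simp
    then obtain a y where v: "v = word a @ E # y" using less.hyps w by fastforce
    then have "height y < 0" using less.prems w N by simp
    then obtain a' y' where "y = word a' @ E # y'" using less.hyps[of y] w v by fastforce
    then have "w = word (Nd a a') @ E # y'" using w v N by simp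
    then show ?thesis by blast
  next
    case E
    then have "w = word Lf @ E # v" using w by simp
    then show ?thesis by blast
  qed
qed

lemma dyck_iff: "dyck R \<longleftrightarrow> (\<exists>r. r \<noteq> Lf \<and> R = word r)"
proof
  assume R: "dyck R"
  have nonneg: "0 \<le> height (take i R)" if "i \<le> length R" for i
    using R that hdist_point[of R i] by (auto simp: dyck_def hdist_def)
  have zero: "height R = 0"
    using R hdist_point[of R "length R"] by (auto simp: dyck_def hdist_def)
  \<comment> \<open>The extra \<open>E\<close> makes the parsing lemma applicable. It must be the
    \<open>E\<close> found there, since otherwise \<open>R\<close> would have a prefix of height
    -1.\<close>
  then have "height (R @ [E]) < 0" by simp
  then obtain a y where a: "R @ [E] = word a @ E # y" using negative_height_parse by blast
  have "y = []"
  proof (rule ccontr)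
    assume "y \<noteq> []"
    then have y: "y = butlast y @ [last y]" by simp
    have "butlast (R @ [E]) = butlast (word a @ E # y)" using a by simp
    then have "R = (word a @ [E]) @ butlast y" using \<open>y \<noteq> []\<close> by (simp add: butlast_append)
    then show False using nonneg[of "length (word a @ [E])"] by simp
  qed
  then have "R = word a" using a by simp
  moreover have "R \<noteq> []" using R by (simp add: dyck_def)
  ultimately show "\<exists>r. r \<noteq> Lf \<and> R = word r" by auto
next
  assume "\<exists>r. r \<noteq> Lf \<and> R = word r"
  then obtain r where r: "r \<noteq> Lf" "R = word r" by blast
  have "word r \<noteq> []" using r by (cases r) auto
  moreover have "fst (point R i) \<le> snd (point R i)" for i
    using height_take_word[of i r] hdist_point[of R i] r by (simp add: hdist_def)
  moreover have "fst (point R (length R)) = snd (point R (length R))"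
    using hdist_point[of R "length R"] r by (simp add: hdist_def)
  ultimately show "dyck R" using r unfolding dyck_def by auto
qed

section \<open>Tamari covers of words and rotations of trees\<close>

lemma word_in_dyck_paths_iff: "word r \<in> dyck_paths (2 * n) \<longleftrightarrow> r \<noteq> Lf \<and> size r = n"
  by (auto simp: dyck_paths_def dyck_iff)

text \<open>The sub-path between the valley and the next point of the same distance starts with
  \<open>N\<close> and regains its initial height only at its end, so it is
  \<open>N # word b @ [E]\<close> for a single tree \<open>b\<close>. \<open>A\<close> and
  \<open>C\<close> are arbitrary words, so that the factorization can be carried through a recursion
  on trees.\<close>

lemma tamari_cover_iff_factorization:
  "tamari_cover R R' \<longleftrightarrow>
    (\<exists>A b C. R = A @ E # N # word b @ E # C \<and> R' = A @ N # word b @ E # E # C)"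
proof
  assume "tamari_cover R R'"
  then obtain i j where v: "valley R i" and nx: "next_same_hdist R i j"
    and R': "R' = take (i - 1) R @ take (j - i) (drop i R) @ [E] @ drop j R"
    unfolding tamari_cover_def by blast
  define B where "B = take (j - i) (drop i R)"
  from v have i: "0 < i" "i < length R" "R ! (i - 1) = E" "R ! i = N"
    by (auto simp: valley_def)
  from nx have j: "i < j" "j \<le> length R" by (auto simp: next_same_hdist_def)
  have take_B: "take (i + k) R = take i R @ take k B" if "k \<le> j - i" for k
    using that by (simp add: B_def take_add)
  have drop_i: "drop i R = B @ drop j R"
    using append_take_drop_id[of "j - i" "drop i R"] j by (simp add: B_def)
  have drop_i1: "drop (i - 1) R = E # drop i R"
    using i Cons_nth_drop_Suc[of "i - 1" R] by simp
  have "R = take (i - 1) R @ drop (i - 1) R" by simp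
  also have "drop (i - 1) R = E # B @ drop j R" using drop_i1 drop_i by simp
  finally have R: "R = take (i - 1) R @ E # B @ drop j R" .
  have hB: "height B = 0"
    using nx j take_B[of "j - i"] by (simp add: next_same_hdist_def hdist_point B_def)
  have hB': "height (take k B) \<noteq> 0" if "0 < k" "k < j - i" for k
  proof -
    have "hdist (point R (i + k)) \<noteq> hdist (point R i)"
      using nx that by (auto simp: next_same_hdist_def)
    then show ?thesis using take_B[of k] that by (simp add: hdist_point)
  qed
  have lenB: "length B = j - i" using j by (simp add: B_def)
  obtain B' where B': "B = N # B'"
  proof -
    have "drop i R = N # drop (Suc i) R" using i Cons_nth_drop_Suc[of i R] by simp
    moreover obtain m where "j - i = Suc m" using j by (cases "j - i") auto
    ultimately show ?thesis using that by (simp add: B_def)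
  qed
  then have "height B' < 0" using hB by simp
  then obtain b y where b: "B' = word b @ E # y" using negative_height_parse by blast
  \<comment> \<open>A nonempty \<open>y\<close> would make the end of
    \<open>N # word b @ [E]\<close> a return strictly before \<open>j\<close>.\<close>
  have "y = []"
  proof (rule ccontr)
    assume "y \<noteq> []"
    then have "2 * size b + 2 < j - i"
      using lenB B' b by (cases y) auto
    then have "height (take (2 * size b + 2) B) \<noteq> 0" using hB' by simp
    then show False using B' b by simp
  qed
  then show "\<exists>A b C. R = A @ E # N # word b @ E # C \<and> R' = A @ N # word b @ E # E # C"
  proof (intro exI conjI)
    show "R = take (i - 1) R @ E # N # word b @ E # drop j R"
      by (rule trans[OF R]) (simp add: B' b \<open>y = []\<close>)
    show "R' = take (i - 1) R @ N # word b @ E # E # drop j R"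
      by (rule trans[OF R'[folded B_def]]) (simp add: B' b \<open>y = []\<close>)
  qed
next
  assume "\<exists>A b C. R = A @ E # N # word b @ E # C \<and> R' = A @ N # word b @ E # E # C"
  then obtain A b C where R: "R = A @ E # N # word b @ E # C"
    and R': "R' = A @ N # word b @ E # E # C" by blast
  define i where "i = Suc (length A)"
  define j where "j = i + Suc (Suc (2 * size b))"
  have "valley R i" by (simp add: valley_def i_def R nth_append)
  have between: "height (take k R) \<noteq> height (take i R)" if k: "i < k" "k < j" for k
  proof -
    define l where "l = k - i - 1"
    have l: "k = length A + Suc (Suc l)" "l \<le> 2 * size b" using k by (auto simp: l_def i_def j_def)
    show ?thesis using height_take_word[of l b] l by (simp add: R i_def)
  qed
  have split_R: "(A @ E # N # word b @ [E]) @ C = R" "length (A @ E # N # word b @ [E]) = j"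
    by (simp_all add: R i_def j_def)
  then have split_j: "take j R = A @ E # N # word b @ [E]" "drop j R = C"
    by (metis append_eq_conv_conj)+
  have "height (take j R) = height (take i R)"
    unfolding split_j(1) by (simp add: R i_def)
  moreover have "j \<le> length R" using arg_cong[OF split_R(1), of length] split_R(2) by simp
  moreover have "i < j" by (simp add: j_def)
  ultimately have "next_same_hdist R i j"
    using between unfolding next_same_hdist_def hdist_point by blast
  moreover have "R' = take (i - 1) R @ take (j - i) (drop i R) @ [E] @ drop j R"
    unfolding split_j(2) by (simp add: R R' i_def j_def)
  ultimately show "tamari_cover R R'" using \<open>valley R i\<close> unfolding tamari_cover_def by blast
qed

lemma tree_cov_imp_factorization:
  assumes "tree_cov r r'"
  shows "\<exists>A b C. word r = A @ E # N # word b @ E # C \<and> word r' = A @ N # word b @ E # E # C"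
  using assms
proof (induction rule: tree_cov.induct)
  case (rotate a b c)
  show ?case
    by (intro exI[of _ "N # word a"] exI[of _ b] exI[of _ "word c"]) simp
next
  case (left a a' c)
  then obtain A b C where "word a = A @ E # N # word b @ E # C"
    "word a' = A @ N # word b @ E # E # C" by blast
  then show ?case
    by (intro exI[of _ "N # A"] exI[of _ b] exI[of _ "C @ E # word c"]) simp
next
  case (right c c' a)
  then obtain A b C where "word c = A @ E # N # word b @ E # C"
    "word c' = A @ N # word b @ E # E # C" by blast
  then show ?case
    by (intro exI[of _ "N # word a @ E # A"] exI[of _ b] exI[of _ C]) simp
qed

text \<open>The pattern \<open>E # N # word b @ [E]\<close> either starts at the \<open>E\<close>
  closing the root, which gives a rotation there, or lies entirely in \<open>word a\<close> or
  entirely in \<open>word c\<close>.\<close>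

lemma factorization_imp_tree_cov:
  assumes "word r = A @ E # N # word b @ E # C"
  shows "\<exists>r'. tree_cov r r' \<and> word r' = A @ N # word b @ E # E # C"
  using assms
proof (induction r arbitrary: A C)
  case (Nd a c)
  obtain A1 where A: "A = N # A1" using Nd.prems by (cases A) auto
  have eq: "word a @ E # word c = A1 @ E # N # word b @ E # C" using Nd.prems A by simp
  have rot: ?case if a: "word a = A1" and c: "word c = N # word b @ E # C"
  proof -
    obtain b' c' where c': "c = Nd b' c'" using c by (cases c) auto
    then have "b' = b" "C = word c'" using c word_append_E_eq_iff by auto
    then show ?thesis using tree_cov.rotate[of a b c'] a c' A by force
  qed
  from eq consider us where "word a = A1 @ us" "us @ E # word c = E # N # word b @ E # C"
    | us where "word a @ us = A1" "E # word c = us @ E # N # word b @ E # C"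
    unfolding append_eq_append_conv2 by blast
  then show ?case
  proof cases
    case 1
    show ?thesis
    proof (cases us)
      case Nil
      then show ?thesis using rot 1 by simp
    next
      case (Cons s us')
      then have us: "us = E # us'" and us': "us' @ E # word c = (N # word b @ [E]) @ C"
        using 1 by auto
      have "0 \<le> height (A1 @ [E])"
        using height_prefix_word[of a "A1 @ [E]" us'] 1 us by simp
      moreover have "height (word a) = height (A1 @ [E]) + height us'" using 1 us by simp
      ultimately have h: "height us' \<le> 0" by simp
      from us' consider vs where "us' = (N # word b @ [E]) @ vs" "vs @ E # word c = C"
        | vs where "us' @ vs = N # word b @ [E]" "vs \<noteq> []" "E # word c = vs @ C"
        unfolding append_eq_append_conv2 by (metis append_Nil append_Nil2)
      then show ?thesis
      proof cases
        case (1 vs)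
        then have "word a = A1 @ E # N # word b @ E # vs" using \<open>word a = A1 @ us\<close> us by simp
        from Nd.IH(1)[OF this] obtain a' where
          "tree_cov a a'" "word a' = A1 @ N # word b @ E # E # vs" by blast
        then show ?thesis using A 1(2) by (intro exI[of _ "Nd a' c"]) (auto intro: tree_cov.left)
      next
        \<comment> \<open>Here the pattern would straddle the closing \<open>E\<close> of the root.
          Then \<open>us'\<close> is \<open>N\<close> followed by a prefix of \<open>word b\<close>,
          so its height is positive, against \<open>h\<close>.\<close>
        case (2 vs)
        have "us' \<noteq> []" using us' by auto
        then obtain us'' where us'': "us' = N # us''" using us' by (cases us') auto
        then have "us'' @ vs = word b @ [E]" using 2 by simp
        then have "word b = us'' @ butlast vs"
          using 2(2) by (metis butlast_append butlast_snoc)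
        then have "0 \<le> height us''" by (rule height_prefix_word)
        then show ?thesis using h us'' by simp
      qed
    qed
  next
    case 2
    show ?thesis
    proof (cases us)
      case Nil
      then show ?thesis using rot 2 by simp
    next
      case (Cons s us')
      then have "word c = us' @ E # N # word b @ E # C" using 2 by simp
      from Nd.IH(2)[OF this] obtain c' where
        "tree_cov c c'" "word c' = us' @ N # word b @ E # E # C" by blast
      then show ?thesis using A 2 Cons by (intro exI[of _ "Nd a c'"]) (auto intro: tree_cov.right)
    qed
  qed
qed simp

lemma tamari_cover_word_iff:
  "tamari_cover (word r) R' \<longleftrightarrow> (\<exists>r'. tree_cov r r' \<and> R' = word r')"
  unfolding tamari_cover_iff_factorization
  using tree_cov_imp_factorization factorization_imp_tree_cov by metis

lemma tamari_le_word_iff: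
  "tamari_le (2 * n) (word r) (word s) \<longleftrightarrow> r \<noteq> Lf \<and> size r = n \<and> tree_tam r s"
proof -
  let ?step = "\<lambda>P Q. P \<in> dyck_paths (2 * n) \<and> Q \<in> dyck_paths (2 * n) \<and> tamari_cover P Q"
  have fwd: "\<exists>s. S = word s \<and> tree_cov\<^sup>*\<^sup>* r s" if "?step\<^sup>*\<^sup>* (word r) S" for S
    using that
  proof (induction rule: rtranclp_induct)
    case (step P Q)
    then obtain p where p: "P = word p" "tree_cov\<^sup>*\<^sup>* r p" by blast
    obtain q where q: "tree_cov p q" "Q = word q"
      using step.hyps(2) p(1) tamari_cover_word_iff by blast
    have "tree_cov\<^sup>*\<^sup>* r q" using p(2) q(1) by (rule rtranclp.rtrancl_into_rtrancl)
    then show ?case using q(2) by blast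
  qed auto
  have bwd: "?step\<^sup>*\<^sup>* (word r) (word s) \<and> s \<noteq> Lf \<and> size s = n"
    if "tree_cov\<^sup>*\<^sup>* r s" "r \<noteq> Lf" "size r = n"
    using that
  proof (induction rule: rtranclp_induct)
    case (step p q)
    have "size q = n" using tree_cov_size[OF step.hyps(2)] step.IH step.prems by simp
    moreover have "q \<noteq> Lf" using step.hyps(2) by (auto elim: tree_cov_LfE)
    moreover have IH: "?step\<^sup>*\<^sup>* (word r) (word p)" "p \<noteq> Lf" "size p = n"
      using step.IH step.prems by blast+
    ultimately have "?step (word p) (word q)"
      using step.hyps(2) tamari_cover_word_iff[of p "word q"] by (auto simp: word_in_dyck_paths_iff)
    with IH(1) have "?step\<^sup>*\<^sup>* (word r) (word q)" by (rule rtranclp.rtrancl_into_rtrancl)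
    then show ?case using \<open>q \<noteq> Lf\<close> \<open>size q = n\<close> by blast
  qed auto
  show ?thesis
    using fwd[of "word s"] bwd
    unfolding tamari_le_def word_in_dyck_paths_iff tree_tam_iff_tree_cov_rtranclp by auto
qed

section \<open>Statistics\<close>

text \<open>The analogue of \<open>tree_type\<close> on paths, with an entry for every north step. A
  final \<open>N\<close> would read beyond the list, but in the word of a tree every
  \<open>N\<close> is followed by a step.\<close>

definition north_followed :: "path \<Rightarrow> bool list" where
  "north_followed R = map (\<lambda>k. R ! Suc k = E) (north_indices R)"

lemma north_indices_Cons:
  "north_indices (s # R) = (if s = N then [0] else []) @ map Suc (north_indices R)"
proof -
  have "[0..<length (s # R)] = 0 # map Suc [0..<length R]"
    by (simp add: upt_conv_Cons map_Suc_upt del: upt_Suc)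
  then show ?thesis by (simp add: north_indices_def filter_map o_def)
qed

lemma north_followed_simps [simp]:
  "north_followed [] = []"
  "north_followed (N # R) = (R ! 0 = E) # north_followed R"
  "north_followed (E # R) = north_followed R"
  by (simp_all add: north_followed_def north_indices_Cons o_def) (simp add: north_indices_def)

lemma word_append_E_nth_0: "(word a @ E # w) ! 0 = E \<longleftrightarrow> a = Lf"
  by (cases a) auto

lemma north_followed_word_append: "north_followed (word a @ E # w) = tree_type a @ north_followed w"
proof (induction a arbitrary: w)
  case (Nd a c)
  show ?case by (simp add: Nd.IH word_append_E_nth_0)
qed simp

lemma north_followed_word [simp]: "north_followed (word a) = tree_type a"
proof (induction a)
  case (Nd a c)
  then show ?case by (simp add: north_followed_word_append word_append_E_nth_0)
qed simp

lemma path_type_word: "path_type (word r) = map (\<lambda>b. if b then N else E) (butlast (tree_type r))"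
proof (rule nth_equalityI)
  fix i assume "i < length (path_type (word r))"
  then have i: "i < size r - 1" by (simp add: path_type_def)
  have "length (north_indices (word r)) = size r"
    using arg_cong[OF north_followed_word[of r], of length] by (simp add: north_followed_def)
  then have "word r ! Suc (north_indices (word r) ! i) = E \<longleftrightarrow> north_followed (word r) ! i"
    using i by (simp add: north_followed_def)
  then show "path_type (word r) ! i = map (\<lambda>b. if b then N else E) (butlast (tree_type r)) ! i"
    using i by (simp add: path_type_def nth_butlast)
qed (simp add: path_type_def)

text \<open>\<open>path_type\<close> omits the letter of the last north step, while
  \<open>tree_type\<close> keeps it in order to be compatible with \<open>app\<close>. That letter
  is always the same, so both carry the same information.\<close>

lemma last_tree_type: "r \<noteq> Lf \<Longrightarrow> last (tree_type r)"
proof (induction r)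
  case (Nd a c)
  then show ?case by (cases "c = Lf"; cases "a = Lf") auto
qed simp

lemma path_type_word_eq_iff:
  assumes "r \<noteq> Lf" "s \<noteq> Lf"
  shows "path_type (word r) = path_type (word s) \<longleftrightarrow> tree_type r = tree_type s"
proof
  assume "path_type (word r) = path_type (word s)"
  moreover have "inj (\<lambda>b. if b then N else E)" by (auto simp: inj_def split: if_splits)
  ultimately have "butlast (tree_type r) = butlast (tree_type s)"
    unfolding path_type_word by (metis inj_map_eq_map)
  moreover have "tree_type r = butlast (tree_type r) @ [True]" "tree_type s = butlast (tree_type s) @ [True]"
    using assms last_tree_type append_butlast_last_id[of "tree_type r"] append_butlast_last_id[of "tree_type s"] by auto
  ultimately show "tree_type r = tree_type s" by metis
qed (simp add: path_type_word)

lemma sublist_NNN_append_E: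
  "sublist [N, N, N] (x @ E # y) \<longleftrightarrow> sublist [N, N, N] x \<or> sublist [N, N, N] y"
proof
  assume "sublist [N, N, N] (x @ E # y)"
  then show "sublist [N, N, N] x \<or> sublist [N, N, N] y"
    by (auto simp: sublist_append sublist_Cons_right prefix_Cons Cons_eq_append_conv)
next
  assume "sublist [N, N, N] x \<or> sublist [N, N, N] y"
  then show "sublist [N, N, N] (x @ E # y)"
    by (auto simp: sublist_append sublist_Cons_right)
qed

lemma prefix_NN_word_append: "prefix [N, N] (word a @ E # w) \<longleftrightarrow> \<not> avoids_NN a"
proof (cases a)
  case (Nd b c)
  then show ?thesis by (cases b) auto
qed simp

lemma avoids_NNN_word_iff: "avoids_NNN (word r) \<longleftrightarrow> tree_avoids r"
proof (induction r)
  case (Nd a c)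
  have "sublist [N, N, N] (word (Nd a c)) \<longleftrightarrow>
      prefix [N, N] (word a @ E # word c) \<or> sublist [N, N, N] (word a) \<or> sublist [N, N, N] (word c)"
    by (simp add: sublist_Cons_right sublist_NNN_append_E)
  then show ?case using Nd.IH prefix_NN_word_append[of a "word c"]
    by (simp add: avoids_NNN_def)
qed (simp add: avoids_NNN_def)

section \<open>Contacts and single north steps\<close>

primrec returns :: "dtree \<Rightarrow> nat" where
  "returns Lf = 0"
| "returns (Nd a c) = Suc (returns c)"

lemma cont_word: "cont (word r) = Suc (returns r)"
proof -
  define Z where "Z w = {i \<in> {0..length w}. height (take i w) = 0}" for w
  \<comment> \<open>\<open>cont\<close> counts points and \<open>Z\<close> collects positions on the
    path; the numbers agree because the coordinates of a point add up to the number of steps before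
    it.\<close>
  have inj: "inj_on (point w) {0..length w}" for w
  proof (rule inj_onI)
    fix i j assume ij: "i \<in> {0..length w}" "j \<in> {0..length w}" "point w i = point w j"
    have length_eq: "count_list v E + count_list v N = length v" for v
    proof (induction v)
      case (Cons s v)
      then show ?case by (cases s) auto
    qed simp
    have "fst (point w k) + snd (point w k)
        = int (count_list (take k w) E + count_list (take k w) N)" for k
      by (simp add: point_def)
    then have "int (length (take k w)) = fst (point w k) + snd (point w k)" for k
      by (simp only: length_eq)
    then have "int (length (take i w)) = int (length (take j w))"
      by (simp only: ij(3))
    then show "i = j" using ij(1,2) by simp
  qed
  have "cont w = card (Z w)" for w
  proof -
    have "fst (point w i) = snd (point w i) \<longleftrightarrow> height (take i w) = 0" for i
      using hdist_point[of w i] by (auto simp: hdist_def)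
    then have "{p \<in> point w ` {0..length w}. fst p = snd p} = point w ` Z w"
      unfolding Z_def by blast
    moreover have "inj_on (point w) (Z w)"
      by (rule inj_on_subset[OF inj]) (auto simp: Z_def)
    ultimately show ?thesis by (simp add: cont_def card_image)
  qed
  moreover have "card (Z (word r)) = Suc (returns r)"
  proof (induction r)
    case Lf
    then show ?case by (simp add: Z_def)
  next
    case (Nd a c)
    let ?k = "2 * size a + 2"
    \<comment> \<open>\<open>?k\<close> is the position of the first return; strictly between 0 and
      \<open>?k\<close> the height is positive.\<close>
    have "Z (word (Nd a c)) = insert 0 ((\<lambda>i. i + ?k) ` Z (word c))"
    proof (intro set_eqI iffI)
      fix i assume i: "i \<in> Z (word (Nd a c))"
      show "i \<in> insert 0 ((\<lambda>i. i + ?k) ` Z (word c))"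
      proof (cases i)
        case (Suc l)
        have "\<not> l \<le> 2 * size a"
          using i Suc height_take_word[of l a] by (auto simp: Z_def)
        then have "i = (i - ?k) + ?k" using Suc by simp
        then obtain m where m: "i = m + ?k" by blast
        then have "m \<in> Z (word c)" using i by (auto simp: Z_def)
        then show ?thesis using m by blast
      qed simp
    qed (auto simp: Z_def)
    moreover have "card ((\<lambda>i. i + ?k) ` Z (word c)) = card (Z (word c))"
      by (rule card_image) (simp add: inj_on_def)
    moreover have "0 \<notin> (\<lambda>i. i + ?k) ` Z (word c)" "finite (Z (word c))" by (auto simp: Z_def)
    ultimately show ?case using Nd.IH(2) by simp
  qed
  ultimately show ?thesis by simp
qed

text \<open>Meant for avoiding trees, where \<open>a\<close> is \<open>Lf\<close> in the last
  clause: the word then begins with NNE, whose block has two north steps and counts nothing.\<close>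

fun single_norths :: "dtree \<Rightarrow> nat" where
  "single_norths Lf = 0"
| "single_norths (Nd Lf c) = Suc (single_norths c)"
| "single_norths (Nd (Nd a b) c) = single_norths b + single_norths c"

lemma block_decomposition_Nil: "block_decomposition [] []"
  by (simp add: block_decomposition_def block_word_def)

lemma block_decomposition_Cons:
  "block_decomposition w bs \<Longrightarrow> a \<in> {1, 2} \<Longrightarrow> b \<ge> 1 \<Longrightarrow>
    block_decomposition (replicate a N @ replicate b E @ w) ((a, b) # bs)"
  by (auto simp: block_decomposition_def block_word_def)

lemma block_decomposition_append:
  "block_decomposition v bs \<Longrightarrow> block_decomposition w cs \<Longrightarrow> block_decomposition (v @ w) (bs @ cs)"
  by (auto simp: block_decomposition_def block_word_def)

lemma block_decomposition_snoc_E: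
  assumes "block_decomposition w (bs @ [(a, b)])"
  shows "block_decomposition (w @ [E]) (bs @ [(a, Suc b)])"
proof -
  have "w = block_word bs @ replicate a N @ replicate b E"
    using assms by (simp add: block_decomposition_def block_word_def)
  then have "w @ [E] = block_word bs @ replicate a N @ replicate b E @ [E]" by simp
  also have "\<dots> = block_word (bs @ [(a, Suc b)])"
    by (simp add: block_word_def replicate_append_same)
  finally show ?thesis using assms by (auto simp: block_decomposition_def)
qed

lemma block_decomposition_word:
  assumes "tree_avoids s"
  shows "\<exists>bs. block_decomposition (word s) bs \<and> length (filter (\<lambda>(a, b). a = 1) bs) = single_norths s"
  using assms
proof (induction s rule: single_norths.induct)
  case 1
  then show ?case using block_decomposition_Nil by force
next
  case (2 c)
  then obtain bs where "block_decomposition (word c) bs"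
    "length (filter (\<lambda>(a, b). a = 1) bs) = single_norths c" by auto
  then show ?case
    using block_decomposition_Cons[of "word c" bs 1 1] by (intro exI[of _ "(1, 1) # bs"]) simp
next
  case (3 a b c)
  have [simp]: "a = Lf" using 3 by simp
  from 3 obtain bs cs where bs: "block_decomposition (word b) bs"
      "length (filter (\<lambda>(a, b). a = 1) bs) = single_norths b"
    and cs: "block_decomposition (word c) cs"
      "length (filter (\<lambda>(a, b). a = 1) cs) = single_norths c" by auto
  \<comment> \<open>A local list of blocks, not the statistic of that name. The closing
    \<open>E\<close> of the root lengthens its last block, which is \<open>(2, 1)\<close> if
    \<open>bs\<close> is empty, and changes no number of north steps.\<close>
  define ds where "ds = (2 :: nat, 1 :: nat) # bs"
  have ds: "block_decomposition (N # N # E # word b) ds"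
    using block_decomposition_Cons[OF bs(1), of 2 1] by (simp add: ds_def numeral_2_eq_2)
  obtain ds' p q where ds': "ds = ds' @ [(p, q)]"
    by (metis ds_def list.distinct(1) rev_exhaust surj_pair)
  have "block_decomposition (N # N # E # word b @ [E]) (ds' @ [(p, Suc q)])"
    using block_decomposition_snoc_E[OF ds[unfolded ds']] by simp
  then have "block_decomposition (word (Nd (Nd a b) c)) ((ds' @ [(p, Suc q)]) @ cs)"
    using block_decomposition_append[OF _ cs(1)] by fastforce
  moreover have "length (filter (\<lambda>(a, b). a = 1) (ds' @ [(p, Suc q)])) = single_norths b"
    using bs(2) arg_cong[OF ds'[unfolded ds_def], of "\<lambda>xs. length (filter (\<lambda>(a, b). a = 1) xs)"]
    by (simp split: if_splits)
  ultimately show ?case using cs(2)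
    by (intro exI[of _ "(ds' @ [(p, Suc q)]) @ cs"]) (simp del: append_assoc)
qed

lemma ds_word:
  assumes "tree_avoids s"
  shows "ds (word s) = single_norths s"
proof -
  obtain bs where bs: "block_decomposition (word s) bs"
      "length (filter (\<lambda>(a, b). a = 1) bs) = single_norths s"
    using block_decomposition_word[OF assms] by blast
  have "(THE bs. block_decomposition (word s) bs) = bs"
    using bs(1) block_decomposition_unique by blast
  then show ?thesis using bs(2) by (simp add: ds_def)
qed

section \<open>Synchronized intervals as pairs of trees\<close>

definition sync_pairs :: "nat \<Rightarrow> (dtree \<times> dtree) set" where
  "sync_pairs n = {(r, s). sync_pair r s \<and> size r = n}"

lemma sync_intervals_eq:
  assumes "n \<ge> 1"
  shows "sync_intervals n = map_prod word word ` sync_pairs n"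
proof (intro set_eqI iffI)
  fix p assume "p \<in> sync_intervals n"
  then obtain R S where p: "p = (R, S)" "tamari_le (2 * n) R S" "avoids_NNN R" "avoids_NNN S"
     "path_type R = path_type S" by (auto simp: sync_intervals_def)
  from p(2) have "dyck R" "dyck S" by (auto simp: tamari_le_def dyck_paths_def)
  then obtain r s where rs: "R = word r" "S = word s" "r \<noteq> Lf" "s \<noteq> Lf" by (auto simp: dyck_iff)
  have "(r, s) \<in> sync_pairs n"
    using p rs by (auto simp: sync_pairs_def sync_pair_iff tamari_le_word_iff path_type_word_eq_iff avoids_NNN_word_iff)
  then show "p \<in> map_prod word word ` sync_pairs n" using p rs by force
next
  fix p assume "p \<in> map_prod word word ` sync_pairs n"
  then obtain r s where p: "p = (word r, word s)" "sync_pair r s" "size r = n" by (auto simp: sync_pairs_def)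
  then have "r \<noteq> Lf" "s \<noteq> Lf" using assms by (auto simp: sync_pair_iff dest: tree_tam_size)
  then show "p \<in> sync_intervals n"
    using p by (auto simp: sync_intervals_def sync_pair_iff tamari_le_word_iff path_type_word_eq_iff avoids_NNN_word_iff)
qed

section \<open>The functional equation\<close>

abbreviation weight :: "dtree \<times> dtree \<Rightarrow> rat poly poly" where
  "weight rs \<equiv> var_u ^ single_norths (snd rs) * var_x ^ returns (fst rs)"

lemma sync_pairs_0: "sync_pairs 0 = {(Lf, Lf)}"
proof -
  have "sync_pair r s \<Longrightarrow> size r = 0 \<Longrightarrow> r = Lf \<and> s = Lf" for r s
    by (cases r) (auto simp: sync_pair_iff dest: tree_tam_LfD)
  then show ?thesis by (auto simp: sync_pairs_def sync_pair.Lf)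
qed

lemma inj_word_pair: "inj (map_prod word word)"
  by (auto simp: inj_def)

lemma finite_sync_pairs: "finite (sync_pairs n)"
proof (cases n)
  case (Suc m)
  then have "finite (map_prod word word ` sync_pairs n)"
    using finite_sync_intervals[of n] by (simp add: sync_intervals_eq)
  then show ?thesis
    by (rule finite_imageD) (rule inj_on_subset[OF inj_word_pair], simp)
qed (simp add: sync_pairs_0)

lemma sync_pair_size: "sync_pair r s \<Longrightarrow> size s = size r"
  by (auto simp: sync_pair_iff dest: tree_tam_size)

definition splits :: "dtree \<Rightarrow> (dtree \<times> dtree) set" where
  "splits p = {(l, r). app l r = p}"

lemma splits_Lf: "splits Lf = {(Lf, Lf)}"
proof -
  have "app l r = Lf \<longleftrightarrow> l = Lf \<and> r = Lf" for l r by (cases l) auto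
  then show ?thesis by (auto simp: splits_def)
qed

lemma splits_Nd: "splits (Nd a c) = insert (Lf, Nd a c) ((\<lambda>(l, r). (Nd a l, r)) ` splits c)"
proof -
  have "app l r = Nd a c \<longleftrightarrow> l = Lf \<and> r = Nd a c \<or> (\<exists>l'. l = Nd a l' \<and> app l' r = c)" for l r
    by (cases l) auto
  then show ?thesis by (force simp: splits_def)
qed

lemma finite_splits: "finite (splits p)"
  by (induction p) (auto simp: splits_Lf splits_Nd)

text \<open>A tree with m returns can be cut in m + 1 ways, and the right part takes each number of
  returns from 0 to m once. For powers of x this is the sum 1 + ... + x^m behind the factor x - 1 of
  the functional equation.\<close>

lemma sum_splits:
  fixes f :: "nat \<Rightarrow> 'a :: comm_monoid_add"
  shows "(\<Sum>lr\<in>splits p. f (returns (snd lr))) = (\<Sum>i\<le>returns p. f i)"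
proof (induction p)
  case Lf
  then show ?case by (simp add: splits_Lf)
next
  case (Nd a c)
  have "(\<Sum>lr\<in>splits (Nd a c). f (returns (snd lr)))
      = f (Suc (returns c)) + (\<Sum>lr\<in>(\<lambda>(l, r). (Nd a l, r)) ` splits c. f (returns (snd lr)))"
    unfolding splits_Nd by (subst sum.insert) (auto simp: finite_splits)
  also have "(\<Sum>lr\<in>(\<lambda>(l, r). (Nd a l, r)) ` splits c. f (returns (snd lr)))
      = (\<Sum>lr\<in>splits c. f (returns (snd lr)))"
    by (subst sum.reindex) (auto simp: inj_on_def case_prod_unfold)
  finally show ?case using Nd.IH(2) by (simp add: add.commute)
qed

text \<open>The size \<open>k\<close> of the tree to be cut is kept as a component so that the sum
  over all double nodes becomes a convolution.\<close>

definition double_domain :: "nat \<Rightarrow> (nat \<times> ((dtree \<times> dtree) \<times> (dtree \<times> dtree)) \<times> (dtree \<times> dtree)) set" where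
  "double_domain n = (SIGMA k:{..<n}. (SIGMA pc:sync_pairs k. splits (fst pc)) \<times> sync_pairs (n - 1 - k))"

definition double_node ::
    "nat \<times> ((dtree \<times> dtree) \<times> (dtree \<times> dtree)) \<times> (dtree \<times> dtree) \<Rightarrow> dtree \<times> dtree" where
  "double_node = (\<lambda>(k, ((p, c), (pl, pr)), (p2, q2)).
     (Nd (Nd Lf pl) (app pr p2), Nd (Nd Lf c) q2))"

text \<open>The node shows \<open>pr\<close> and \<open>p2\<close> only as \<open>app pr p2\<close>,
  but \<open>p2\<close> has the size of \<open>q2\<close>, which is visible; this determines the
  cut.\<close>

lemma inj_on_double_node: "inj_on double_node (double_domain n)"
proof (rule inj_onI)
  fix d d' assume d: "d \<in> double_domain n" and d': "d' \<in> double_domain n"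
    and eq: "double_node d = double_node d'"
  obtain k p c pl pr p2 q2 where d_eq: "d = (k, ((p, c), (pl, pr)), (p2, q2))"
    by (metis surj_pair)
  obtain k' p' c' pl' pr' p2' q2' where d'_eq: "d' = (k', ((p', c'), (pl', pr')), (p2', q2'))"
    by (metis surj_pair)
  from d have 1: "size p = k" "app pl pr = p" "sync_pair p2 q2"
    by (auto simp: d_eq double_domain_def sync_pairs_def splits_def)
  from d' have 2: "size p' = k'" "app pl' pr' = p'" "sync_pair p2' q2'"
    by (auto simp: d'_eq double_domain_def sync_pairs_def splits_def)
  from eq have 3: "pl = pl'" "app pr p2 = app pr' p2'" "c = c'" "q2 = q2'"
    by (auto simp: d_eq d'_eq double_node_def)
  have "size p2 = size p2'" using sync_pair_size[OF 1(3)] sync_pair_size[OF 2(3)] 3 by simp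
  then have "size pr = size pr'" using arg_cong[OF 3(2), of size] by simp
  from app_eq_app_size[OF 3(2) this] 1 2 3 show "d = d'" by (auto simp: d_eq d'_eq)
qed

lemma sync_pairs_Suc:
  "sync_pairs (Suc n) = (\<lambda>(p, q). (Nd Lf p, Nd Lf q)) ` sync_pairs n \<union> double_node ` double_domain n"
  (is "_ = ?A \<union> ?B")
proof (intro set_eqI iffI)
  fix x assume "x \<in> sync_pairs (Suc n)"
  then obtain r s where x: "x = (r, s)" and rs: "sync_pair r s" "size r = Suc n" by (auto simp: sync_pairs_def)
  from rs(1) show "x \<in> ?A \<union> ?B"
  proof (cases rule: sync_pair.cases)
    case Lf
    then show ?thesis using rs by simp
  next
    case (single p q)
    then have "(p, q) \<in> sync_pairs n" using rs by (simp add: sync_pairs_def)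
    then show ?thesis using x single by force
  next
    case (double pl pr c p q)
    define k where "k = size (app pl pr)"
    \<comment> \<open>The root and its left child account for two of the \<open>Suc n\<close>
      nodes.\<close>
    have "k < n" "size p = n - 1 - k" using rs double by (auto simp: k_def)
    then have "(k, ((app pl pr, c), (pl, pr)), (p, q)) \<in> double_domain n"
      using double by (auto simp: double_domain_def sync_pairs_def splits_def k_def)
    moreover have "x = double_node (k, ((app pl pr, c), (pl, pr)), (p, q))"
      using x double by (simp add: double_node_def)
    ultimately show ?thesis by blast
  qed
next
  fix x assume "x \<in> ?A \<union> ?B"
  then show "x \<in> sync_pairs (Suc n)"
  proof
    assume "x \<in> ?A"
    then show ?thesis by (auto simp: sync_pairs_def sync_pair.single)
  next
    assume "x \<in> ?B"
    then show ?thesis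
      by (auto simp: double_domain_def sync_pairs_def splits_def double_node_def intro: sync_pair.double)
  qed
qed

definition a_coeff :: "nat \<Rightarrow> rat poly poly" where
  "a_coeff n = (\<Sum>rs\<in>sync_pairs n. weight rs)"

definition b_coeff :: "nat \<Rightarrow> rat poly poly" where
  "b_coeff n = (\<Sum>rs\<in>sync_pairs n. var_u ^ single_norths (snd rs))"

text \<open>The coefficients of (x W - W1) / (x - 1), written without a division.\<close>

definition h_coeff :: "nat \<Rightarrow> rat poly poly" where
  "h_coeff n = (\<Sum>rs\<in>sync_pairs n. var_u ^ single_norths (snd rs) * (\<Sum>i\<le>returns (fst rs). var_x ^ i))"

lemma h_coeff_eq: "(var_x - 1) * h_coeff n = var_x * a_coeff n - b_coeff n"
proof -
  have "(var_x - 1) * (\<Sum>i\<le>m. var_x ^ i) = var_x * var_x ^ m - 1" for m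
    using sum_gp_basic[of var_x m] by (simp add: algebra_simps)
  then have "(var_x - 1) * (var_u ^ j * (\<Sum>i\<le>m. var_x ^ i))
      = var_x * (var_u ^ j * var_x ^ m) - var_u ^ j" for j m
    by (metis (no_types, opaque_lifting) mult.left_commute mult.right_neutral right_diff_distrib')
  then show ?thesis
    by (simp add: h_coeff_def a_coeff_def b_coeff_def sum_distrib_left sum_subtractf)
qed

lemma sum_Sigma_splits:
  "(\<Sum>pc\<in>sync_pairs k. \<Sum>lr\<in>splits (fst pc). f (pc, lr)) = (\<Sum>e\<in>(SIGMA pc:sync_pairs k. splits (fst pc)). f e)"
  by (simp add: sum.Sigma finite_sync_pairs finite_splits case_prod_unfold)

lemma a_coeff_Suc:
  "a_coeff (Suc n) = var_u * var_x * a_coeff n +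
     (\<Sum>k<n. var_x * h_coeff k * a_coeff (n - 1 - k))"
proof -
  let ?f = "\<lambda>(p, q). (Nd Lf p, Nd Lf q)"
  have fin: "finite (double_domain n)"
    unfolding double_domain_def by (intro finite_SigmaI finite_sync_pairs finite_splits finite_lessThan)
  have "a_coeff (Suc n) = (\<Sum>rs\<in>?f ` sync_pairs n. weight rs) + (\<Sum>rs\<in>double_node ` double_domain n. weight rs)"
    unfolding a_coeff_def sync_pairs_Suc
    by (rule sum.union_disjoint) (auto simp: finite_sync_pairs fin double_node_def)
  also have "(\<Sum>rs\<in>?f ` sync_pairs n. weight rs) = var_u * var_x * a_coeff n"
    by (subst sum.reindex)
       (auto simp: inj_on_def a_coeff_def sum_distrib_left case_prod_unfold mult_ac intro!: sum.cong)
  also have "(\<Sum>rs\<in>double_node ` double_domain n. weight rs)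
      = (\<Sum>d\<in>double_domain n. weight (double_node d))"
    by (subst sum.reindex[OF inj_on_double_node]) simp
  also have "\<dots> = (\<Sum>k<n. \<Sum>d\<in>(SIGMA pc:sync_pairs k. splits (fst pc)) \<times> sync_pairs (n - 1 - k).
      weight (double_node (k, d)))"
    unfolding double_domain_def
    by (subst sum.Sigma) (auto intro!: finite_SigmaI finite_sync_pairs finite_splits)
  also have "\<dots> = (\<Sum>k<n. var_x * h_coeff k * a_coeff (n - 1 - k))"
  proof (rule sum.cong[OF refl])
    fix k
    have "(\<Sum>d\<in>(SIGMA pc:sync_pairs k. splits (fst pc)) \<times> sync_pairs (n - 1 - k). weight (double_node (k, d)))
       = (\<Sum>e\<in>(SIGMA pc:sync_pairs k. splits (fst pc)). \<Sum>rs\<in>sync_pairs (n - 1 - k). weight (double_node (k, e, rs)))"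
      by (simp add: sum.cartesian_product case_prod_unfold)
    also have "\<dots> = (\<Sum>pc\<in>sync_pairs k. \<Sum>lr\<in>splits (fst pc). \<Sum>rs\<in>sync_pairs (n - 1 - k).
        weight (double_node (k, (pc, lr), rs)))"
      by (rule sum_Sigma_splits[symmetric])
    \<comment> \<open>A double node has one return of its own besides those of \<open>pr\<close> and
      \<open>p2\<close>, and its block with NN contributes no factor u.\<close>
    also have "\<dots> = (\<Sum>pc\<in>sync_pairs k. \<Sum>lr\<in>splits (fst pc). \<Sum>rs\<in>sync_pairs (n - 1 - k).
        var_x * var_u ^ single_norths (snd pc) * var_x ^ returns (snd lr) * weight rs)"
    proof (intro sum.cong refl)
      fix pc lr rs :: "dtree \<times> dtree"
      have "returns (app r c) = returns r + returns c" for r c by (induction r) auto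
      then show "weight (double_node (k, (pc, lr), rs)) =
        var_x * var_u ^ single_norths (snd pc) * var_x ^ returns (snd lr) * weight rs"
        by (cases pc; cases lr; cases rs) (simp add: double_node_def power_add mult_ac)
    qed
    also have "\<dots> = (\<Sum>pc\<in>sync_pairs k. var_x * var_u ^ single_norths (snd pc) *
        (\<Sum>lr\<in>splits (fst pc). var_x ^ returns (snd lr)) * a_coeff (n - 1 - k))"
      by (simp add: a_coeff_def flip: sum_distrib_left sum_distrib_right)
    also have "\<dots> = var_x * h_coeff k * a_coeff (n - 1 - k)"
      by (simp add: h_coeff_def sum_splits sum_distrib_left sum_distrib_right mult_ac)
    finally show "(\<Sum>d\<in>(SIGMA pc:sync_pairs k. splits (fst pc)) \<times> sync_pairs (n - 1 - k). weight (double_node (k, d)))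
       = var_x * h_coeff k * a_coeff (n - 1 - k)" .
  qed
  finally show ?thesis .
qed

abbreviation "fps_u \<equiv> fps_const var_u"
abbreviation "fps_x \<equiv> fps_const var_x"

definition W :: "rat poly poly fps" where "W = Abs_fps a_coeff"

definition W\<^sub>1 :: "rat poly poly fps" where "W\<^sub>1 = Abs_fps b_coeff"

lemma a_coeff_0: "a_coeff 0 = 1"
  by (simp add: a_coeff_def sync_pairs_0)

lemma W_eq: "W = 1 + F_circ"
proof (rule fps_ext)
  fix n
  show "fps_nth W n = fps_nth (1 + F_circ) n"
  proof (cases "n \<ge> 1")
    case True
    have "(\<Sum>(R, S)\<in>sync_intervals n. var_u ^ ds S * var_x ^ (cont R - 1))
        = (\<Sum>rs\<in>sync_pairs n. var_u ^ ds (word (snd rs)) * var_x ^ (cont (word (fst rs)) - 1))"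
      unfolding sync_intervals_eq[OF True]
      by (subst sum.reindex[OF inj_on_subset[OF inj_word_pair]]) (auto simp: case_prod_unfold)
    also have "\<dots> = a_coeff n"
      unfolding a_coeff_def by (rule sum.cong) (auto simp: sync_pairs_def sync_pair_iff ds_word cont_word)
    finally show ?thesis using True by (simp add: W_def F_circ_def)
  next
    case False
    then have "n = 0" by simp
    then show ?thesis by (simp add: W_def F_circ_def a_coeff_0)
  qed
qed

lemma W_functional_equation:
  "(fps_x - 1) * (W - 1) = fps_X * fps_x * W * (fps_u * (fps_x - 1) + fps_X * (fps_x * W - W\<^sub>1))"
proof -
  define H where "H = Abs_fps h_coeff"
  \<comment> \<open>The double nodes carry t^2 because two of their north steps lie outside the two
    smaller pairs.\<close>
  have W: "W = 1 + fps_X * (fps_u * fps_x * W + fps_X * (fps_x * H * W))"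
  proof (rule fps_ext)
    fix n
    show "fps_nth W n = fps_nth (1 + fps_X * (fps_u * fps_x * W + fps_X * (fps_x * H * W))) n"
    proof (cases n)
      case (Suc m)
      have "fps_nth (fps_X * (fps_x * H * W)) m = (\<Sum>k<m. var_x * h_coeff k * a_coeff (m - 1 - k))"
      proof (cases m)
        case (Suc l)
        have "fps_nth (fps_x * H * W) l = (\<Sum>k=0..l. fps_nth (fps_x * H) k * fps_nth W (l - k))"
          by (rule fps_mult_nth)
        also have "\<dots> = (\<Sum>k<m. var_x * h_coeff k * a_coeff (m - 1 - k))"
          using Suc by (intro sum.cong) (auto simp: H_def W_def)
        finally show ?thesis using Suc by simp
      qed simp
      then show ?thesis using Suc by (simp add: W_def a_coeff_Suc mult.assoc)
    qed (simp add: W_def a_coeff_0)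
  qed
  have H: "(fps_x - 1) * H = fps_x * W - W\<^sub>1"
  proof (rule fps_ext)
    fix n
    have x: "fps_x - 1 = fps_const (var_x - 1)" by (simp flip: fps_const_sub)
    show "fps_nth ((fps_x - 1) * H) n = fps_nth (fps_x * W - W\<^sub>1) n"
      unfolding x by (simp add: H_def W_def W\<^sub>1_def h_coeff_eq)
  qed
  have "W - 1 = fps_X * (fps_u * fps_x * W + fps_X * (fps_x * H * W))"
    unfolding diff_eq_eq by (subst add.commute) (rule W)
  then have "(fps_x - 1) * (W - 1) = (fps_x - 1) * (fps_X * (fps_u * fps_x * W + fps_X * (fps_x * H * W)))"
    by (rule arg_cong)
  also have "\<dots> = fps_X * fps_x * W * (fps_u * (fps_x - 1) + fps_X * ((fps_x - 1) * H))"
    by algebra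
  finally show ?thesis unfolding H .
qed

section \<open>Differentiation and substitution in the catalytic variable\<close>

text \<open>The derivative in x, the inner polynomial variable. It provides the second equation for
  the double root, and \<open>dx f = 0\<close> expresses that \<open>f\<close> is free of x.\<close>

definition dx :: "rat poly poly fps \<Rightarrow> rat poly poly fps" where
  "dx f = Abs_fps (\<lambda>n. map_poly pderiv (fps_nth f n))"

lemma map_poly_pderiv_add: "map_poly pderiv (p + q) = map_poly pderiv p + map_poly pderiv q"
  by (intro poly_eqI) (simp add: coeff_map_poly pderiv_add)

lemma map_poly_pderiv_mult:
  fixes p q :: "rat poly poly"
  shows "map_poly pderiv (p * q) = map_poly pderiv p * q + p * map_poly pderiv q"
proof (rule poly_eqI)
  fix n
  have "pderiv (\<Sum>i\<in>A. f i) = (\<Sum>i\<in>A. pderiv (f i))" for A :: "nat set" and f :: "nat \<Rightarrow> rat poly"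
    using higher_pderiv_sum[of 1] by simp
  then show "coeff (map_poly pderiv (p * q)) n = coeff (map_poly pderiv p * q + p * map_poly pderiv q) n"
    by (simp add: coeff_map_poly coeff_mult pderiv_mult flip: sum.distrib) (simp add: mult_ac add_ac)
qed

lemma map_poly_pderiv_sum: "map_poly pderiv (\<Sum>i\<in>A. f i) = (\<Sum>i\<in>A. map_poly pderiv (f i))"
  by (induction A rule: infinite_finite_induct) (auto simp: map_poly_pderiv_add)

lemma dx_add: "dx (f + g) = dx f + dx g"
  by (rule fps_ext) (simp add: dx_def map_poly_pderiv_add)

lemma dx_diff: "dx (f - g) = dx f - dx g"
  using dx_add[of "f - g" g] by simp

lemma dx_mult: "dx (f * g) = dx f * g + f * dx g"
  by (rule fps_ext) (simp add: dx_def fps_mult_nth map_poly_pderiv_sum map_poly_pderiv_mult sum.distrib)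

lemma dx_fps_const: "dx (fps_const c) = fps_const (map_poly pderiv c)"
  by (rule fps_ext) (simp add: dx_def)

lemma dx_simps [simp]: "dx 1 = 0" "dx fps_X = 0" "dx fps_u = 0" "dx fps_x = 1"
proof -
  have one: "map_poly pderiv (1 :: rat poly poly) = 0"
    by (simp add: one_pCons map_poly_pCons pderiv_1)
  show "dx 1 = 0" "dx fps_X = 0"
    by (rule fps_ext; simp add: dx_def one)+
  show "dx fps_u = 0" "dx fps_x = 1"
    by (simp_all add: dx_fps_const var_u_def var_x_def map_poly_pCons pderiv_pCons one_pCons)
qed

section \<open>Substitution of a series for x\<close>

lemma poly_map_poly_add:
  assumes "h 0 = 0" "\<And>a b. h (a + b) = h a + h b"
  shows "poly (map_poly h (p + q)) z = poly (map_poly h p) z + poly (map_poly h q) z"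
proof -
  have "map_poly h (p + q) = map_poly h p + map_poly h q"
    by (intro poly_eqI) (simp add: coeff_map_poly assms)
  then show ?thesis by simp
qed

lemma poly_map_poly_mult:
  fixes h :: "'a :: comm_ring_1 \<Rightarrow> 'b :: comm_ring_1"
  assumes "h 0 = 0" "\<And>a b. h (a + b) = h a + h b" "\<And>a b. h (a * b) = h a * h b"
  shows "poly (map_poly h (p * q)) z = poly (map_poly h p) z * poly (map_poly h q) z"
proof (induction p)
  case (pCons a p)
  have "map_poly h (smult a q) = smult (h a) (map_poly h q)"
    by (intro poly_eqI) (simp add: coeff_map_poly assms)
  then show ?case
    using pCons.IH by (simp add: map_poly_pCons assms poly_map_poly_add algebra_simps)
qed simp

definition coeff_subst :: "rat poly poly fps \<Rightarrow> rat poly poly \<Rightarrow> rat poly poly fps" where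
  "coeff_subst z p = poly (map_poly (\<lambda>q. poly (map_poly (\<lambda>r. fps_const [:[:r:]:]) q) z) p) fps_u"

context
  fixes z :: "rat poly poly fps"
begin

lemma coeff_subst_inner:
  fixes p q :: "rat poly"
  defines "ev \<equiv> \<lambda>q. poly (map_poly (\<lambda>r. fps_const [:[:r:]:]) q) z"
  shows "ev (p + q) = ev p + ev q" "ev (p * q) = ev p * ev q"
  unfolding ev_def
  by (rule poly_map_poly_add poly_map_poly_mult; simp flip: fps_const_add fps_const_mult)+

lemma coeff_subst_0 [simp]: "coeff_subst z 0 = 0"
  by (simp add: coeff_subst_def)

lemma coeff_subst_add: "coeff_subst z (p + q) = coeff_subst z p + coeff_subst z q"
  unfolding coeff_subst_def by (rule poly_map_poly_add) (simp_all add: coeff_subst_inner)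

lemma coeff_subst_mult: "coeff_subst z (p * q) = coeff_subst z p * coeff_subst z q"
  unfolding coeff_subst_def by (rule poly_map_poly_mult) (simp_all add: coeff_subst_inner)

lemma coeff_subst_sum: "coeff_subst z (\<Sum>i\<in>A. f i) = (\<Sum>i\<in>A. coeff_subst z (f i))"
  by (induction A rule: infinite_finite_induct) (auto simp: coeff_subst_add)

lemma coeff_subst_var_x: "coeff_subst z var_x = z"
proof -
  have "fps_const [:1:] = (1 :: rat poly poly fps)" by (simp flip: one_pCons)
  then show ?thesis by (simp add: coeff_subst_def var_x_def map_poly_pCons flip: one_pCons)
qed

lemma coeff_subst_free_x:
  assumes "map_poly pderiv p = 0"
  shows "coeff_subst z p = fps_const p"
  using assms
proof (induction p)
  case (pCons q p)
  then have "pderiv q = 0" "map_poly pderiv p = 0" by (auto simp: map_poly_pCons)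
  from this(1) obtain r where q: "q = [:r:]"
    using pderiv_eq_0_iff degree_eq_zeroE by metis
  have "pCons q p = [:q:] + var_u * p" by (simp add: var_u_def)
  then have "fps_const (pCons q p) = fps_const [:q:] + fps_u * fps_const p"
    by (simp flip: fps_const_add fps_const_mult)
  moreover have "coeff_subst z (pCons q p) = fps_const [:q:] + fps_u * coeff_subst z p"
    by (simp add: coeff_subst_def map_poly_pCons q)
  ultimately show ?case using pCons.IH[OF \<open>map_poly pderiv p = 0\<close>] by simp
qed simp

text \<open>The sum over n of t^n times the substituted n-th coefficient. Only n at most k
  contribute to t^k, so this makes sense for every \<open>z\<close>, in particular for 1 + Y^2 with
  its constant term 1.\<close>

definition subst_x :: "rat poly poly fps \<Rightarrow> rat poly poly fps" where
  "subst_x f = Abs_fps (\<lambda>k. \<Sum>n\<le>k. fps_nth (coeff_subst z (fps_nth f n)) (k - n))"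

lemma subst_x_add: "subst_x (f + g) = subst_x f + subst_x g"
  by (rule fps_ext) (simp add: subst_x_def coeff_subst_add sum.distrib)

lemma subst_x_diff: "subst_x (f - g) = subst_x f - subst_x g"
  using subst_x_add[of "f - g" g] by simp

lemma subst_x_mult: "subst_x (f * g) = subst_x f * subst_x g"
proof (rule fps_ext)
  fix k
  let ?F = "\<lambda>i j. fps_nth (coeff_subst z (fps_nth f i)) j"
  let ?G = "\<lambda>i j. fps_nth (coeff_subst z (fps_nth g i)) j"
  have "fps_nth (subst_x (f * g)) k = (\<Sum>n\<le>k. \<Sum>i\<le>n. \<Sum>j\<le>k - n. ?F i j * ?G (n - i) (k - n - j))"
    by (simp add: subst_x_def fps_mult_nth coeff_subst_sum coeff_subst_mult fps_sum_nth atLeast0AtMost)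
  also have "\<dots> = (\<Sum>(n, i, j)\<in>(SIGMA n:{..k}. {..n} \<times> {..k - n}). ?F i j * ?G (n - i) (k - n - j))"
    by (simp add: sum.Sigma sum.cartesian_product case_prod_unfold)
  \<comment> \<open>In the first sum \<open>i\<close> and \<open>n - i\<close> are the degrees in t
    taken from \<open>f\<close> and \<open>g\<close>, and \<open>j\<close> is the degree produced by
    the substitution in the coefficient of \<open>f\<close>. Regrouping by \<open>m = i + j\<close>
    collects all that stems from \<open>f\<close>.\<close>
  also have "\<dots> = (\<Sum>(m, i, p)\<in>(SIGMA m:{..k}. {..m} \<times> {..k - m}). ?F i (m - i) * ?G p (k - m - p))"
    by (rule sum.reindex_bij_witness[where i = "\<lambda>(m, i, p). (i + p, i, m - i)"
          and j = "\<lambda>(n, i, j). (i + j, i, n - i)"])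
       (auto simp: add.commute)
  also have "\<dots> = (\<Sum>m\<le>k. \<Sum>i\<le>m. \<Sum>p\<le>k - m. ?F i (m - i) * ?G p (k - m - p))"
    by (simp add: sum.Sigma sum.cartesian_product case_prod_unfold)
  also have "\<dots> = fps_nth (subst_x f * subst_x g) k"
    by (simp add: subst_x_def fps_mult_nth sum_product atLeast0AtMost)
  finally show "fps_nth (subst_x (f * g)) k = fps_nth (subst_x f * subst_x g) k" .
qed

lemma subst_x_const: "subst_x (fps_const c) = coeff_subst z c"
proof (rule fps_ext)
  fix k
  have "fps_nth (subst_x (fps_const c)) k = (\<Sum>n\<in>{0}. fps_nth (coeff_subst z (fps_nth (fps_const c) n)) (k - n))"
    unfolding subst_x_def fps_nth_Abs_fps by (rule sum.mono_neutral_right) auto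
  then show "fps_nth (subst_x (fps_const c)) k = fps_nth (coeff_subst z c) k" by simp
qed

lemma subst_x_free_x:
  assumes "dx f = 0"
  shows "subst_x f = f"
proof (rule fps_ext)
  fix k
  have "map_poly pderiv (fps_nth f n) = 0" for n
    using arg_cong[OF assms, of "\<lambda>g. fps_nth g n"] by (simp add: dx_def)
  then have "fps_nth (subst_x f) k = (\<Sum>n\<le>k. fps_nth (fps_const (fps_nth f n)) (k - n))"
    by (simp add: subst_x_def coeff_subst_free_x)
  also have "\<dots> = (\<Sum>n\<in>{k}. fps_nth (fps_const (fps_nth f n)) (k - n))"
    by (rule sum.mono_neutral_right) auto
  finally show "fps_nth (subst_x f) k = fps_nth f k" by simp
qed

lemma subst_x_simps [simp]:
  "subst_x 1 = 1" "subst_x fps_X = fps_X" "subst_x fps_u = fps_u" "subst_x fps_x = z"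
  by (simp_all add: subst_x_free_x) (simp add: subst_x_const coeff_subst_var_x)

end

lemma dx_W\<^sub>1 [simp]: "dx W\<^sub>1 = 0"
proof -
  have "map_poly pderiv var_u = 0"
    by (simp add: var_u_def map_poly_pCons)
  then have "map_poly pderiv (var_u ^ m) = 0" for m
    by (induction m) (simp_all add: map_poly_pderiv_mult map_poly_pCons one_pCons)
  then show ?thesis by (intro fps_ext) (simp add: dx_def W\<^sub>1_def b_coeff_def map_poly_pderiv_sum)
qed

section \<open>The quadratic method\<close>

text \<open>A contraction argument with divisibility as the distance: \<Phi> gains a factor
  \<open>fps_X\<close> in differences, so the n-th coefficient of the iterates from 0 is constant
  from step n + 1 on.\<close>

lemma fps_fixpoint:
  fixes \<Phi> :: "'a :: comm_ring_1 fps \<Rightarrow> 'a fps"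
  assumes lip: "\<And>f g. fps_X * (f - g) dvd \<Phi> f - \<Phi> g"
  shows "\<exists>y. \<Phi> y = y"
proof -
  define a where "a k = (\<Phi> ^^ k) 0" for k
  have step: "fps_X ^ k dvd a (Suc k) - a k" for k
  proof (induction k)
    case (Suc k)
    have "fps_X ^ Suc k dvd fps_X * (a (Suc k) - a k)"
      using Suc.IH by (simp add: mult_dvd_mono)
    also have "\<dots> dvd \<Phi> (a (Suc k)) - \<Phi> (a k)" by (rule lip)
    finally show ?case by (simp add: a_def)
  qed simp
  have nth_step: "fps_nth (a (Suc k)) n = fps_nth (a k) n" if "n < k" for n k
  proof -
    obtain d where "a (Suc k) - a k = fps_X ^ k * d" using step[of k] by (auto elim: dvdE)
    then have "fps_nth (a (Suc k) - a k) n = 0" using that by (simp add: fps_X_power_mult_nth)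
    then show ?thesis by simp
  qed
  define y where "y = Abs_fps (\<lambda>n. fps_nth (a (Suc n)) n)"
  have nth_y: "fps_nth y n = fps_nth (a k) n" if "n < k" for n k
    using that
  proof (induction k)
    case (Suc k)
    then show ?case using nth_step[of n k] by (cases "n = k") (auto simp: y_def)
  qed simp
  have "fps_nth (\<Phi> y) n = fps_nth y n" for n
  proof -
    obtain d where d: "\<Phi> y - \<Phi> (a (Suc n)) = fps_X * (y - a (Suc n)) * d"
      using lip[of y "a (Suc n)"] by (auto elim: dvdE)
    have "fps_nth ((y - a (Suc n)) * d) m = 0" if "m < Suc n" for m
      using nth_y[of _ "Suc n"] that by (simp add: fps_mult_nth)
    then have "fps_nth (\<Phi> y - \<Phi> (a (Suc n))) n = 0"
      unfolding d mult.assoc by (cases n) auto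
    then have "fps_nth (\<Phi> y) n = fps_nth (a (Suc (Suc n))) n" by (simp add: a_def)
    then show ?thesis using nth_y[of n "Suc (Suc n)"] by simp
  qed
  then show ?thesis by (auto simp: fps_eq_iff)
qed

lemma Y_exists: "\<exists>y :: rat poly poly fps. y = fps_X * (1 + fps_u * y) * (1 + y^2)^2"
proof -
  have "fps_X * (f - g) dvd
      fps_X * (1 + fps_u * f) * (1 + f^2)^2 - fps_X * (1 + fps_u * g) * (1 + g^2)^2" for f g
  proof -
    have "fps_X * (1 + fps_u * f) * (1 + f^2)^2 - fps_X * (1 + fps_u * g) * (1 + g^2)^2 =
      fps_X * (f - g) * (fps_u * (1 + f^2)^2 + (1 + fps_u * g) * (f + g) * (2 + f^2 + g^2))"
      by algebra
    then show ?thesis by simp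
  qed
  from fps_fixpoint[of "\<lambda>y. fps_X * (1 + fps_u * y) * (1 + y^2)^2", OF this]
  show ?thesis by metis
qed

text \<open>
  With \<open>\<delta>\<close> the error of the expected value of \<^term>\<open>W\<^sub>1\<close>, the discriminant and its derivative at
  \<open>1 + y\<^sup>2\<close> are both multiples of \<open>\<delta>\<close>. The discriminant is the square of the derivative of the
  equation in \<open>w\<close>, so comparing orders in \<open>t\<close> forces \<open>\<delta> = 0\<close>.
\<close>

lemma double_root:
  fixes t u y w w' v \<delta> :: "'a :: idom"
  defines "x \<equiv> 1 + y^2"
  defines "B \<equiv> (x - 1) * (t * x * u - 1) - t^2 * x * v"
    and "B' \<equiv> (t * x * u - 1) + (x - 1) * t * u - t^2 * v"
  assumes eq: "(x - 1) * (w - 1) = t * x * w * (u * (x - 1) + t * (x * w - v))"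
    and eq': "(w - 1) + (x - 1) * w' =
      t * (w + x * w') * (u * (x - 1) + t * (x * w - v)) + t * x * w * (u + t * (w + x * w'))"
    and y: "y = t * (1 + u * y) * (1 + y^2)^2"
    and v: "t * v = y * (1 - y^2 - u * y^3) + t * \<delta>"
  shows "(2 * t^2 * x^2 * w + B)^2 = t^3 * x^2 * \<delta> * (4 * y + t * \<delta>)" (is ?A)
    and "\<exists>e. (2 * t^2 * x^2 * w + B) * (4 * t^2 * x * w + 2 * t^2 * x^2 * w' + B') = t^2 * \<delta> * e" (is ?B)
proof -
  \<comment> \<open>\<open>B0\<close> and \<open>B0'\<close> are the values of \<open>B\<close> and
    \<open>B'\<close> for \<delta> = 0.\<close>
  define B0 where "B0 = y^2 * (t * x * u - 1) - t * x * y * (1 - y^2 - u * y^3)"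
  define B0' where "B0' = (t * x * u - 1) + y^2 * t * u - t * y * (1 - y^2 - u * y^3)"
  have B: "B = B0 - t^2 * x * \<delta>" and B': "B' = B0' - t^2 * \<delta>"
    unfolding B_def B'_def B0_def B0'_def x_def using v by algebra+
  \<comment> \<open>The next two identities together say that for \<delta> = 0 the discriminant and
    its x-derivative vanish at x = 1 + y^2.\<close>
  have B0: "B0 = - 2 * t * x * y"
    unfolding B0_def x_def using y by algebra
  have yB0': "y * B0' = - t * (3 * y^2 + 1)"
    unfolding B0'_def x_def using y by algebra
  have "(2 * t^2 * x^2 * w + B)^2 = B^2 - 4 * t^2 * x^2 * (x - 1)"
    unfolding B_def using eq by algebra
  also have "\<dots> = t^3 * x^2 * \<delta> * (4 * y + t * \<delta>)"
    unfolding B B0 unfolding x_def by algebra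
  finally show ?A .
  \<comment> \<open>The second factor is the x-derivative of the first, whose square is the
    discriminant; the product is therefore half the x-derivative of the discriminant.\<close>
  have "(2 * t^2 * x^2 * w + B) * (4 * t^2 * x * w + 2 * t^2 * x^2 * w' + B') =
      B * B' - 2 * t^2 * x * (2 * (x - 1) + x)"
    unfolding B_def B'_def using eq eq' by algebra
  also have "\<dots> = t^2 * \<delta> * (t^2 * x * \<delta> - (B0 + x * B0'))"
    unfolding B B' using B0 yB0' unfolding x_def by algebra
  finally show ?B by blast
qed

lemma W\<^sub>1_eq:
  fixes y :: "rat poly poly fps"
  assumes y: "y = fps_X * (1 + fps_u * y) * (1 + y^2)^2"
  shows "fps_X * W\<^sub>1 = y * (1 - y^2 - fps_u * y^3)"
proof -
  \<comment> \<open>\<open>p\<close> is y / t; with it \<delta> can be defined without a division by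
    t.\<close>
  define p where "p = (1 + fps_u * y) * (1 + y^2)^2"
  have yp: "y = fps_X * p" using y by (simp add: p_def mult.assoc)
  have y0: "fps_nth y 0 = 0" by (subst yp) simp
  have p0: "fps_nth p 0 = 1" by (simp add: p_def y0 power2_eq_square)
  have dy: "dx y = 0"
  proof -
    define q where "q = 1 + y^2"
    have dq: "dx q = 2 * y * dx y"
      by (simp add: q_def dx_add power2_eq_square dx_mult)
    have "dx (fps_X * (1 + fps_u * y) * q^2) =
        fps_X * (fps_u * dx y) * q^2 + fps_X * (1 + fps_u * y) * (dx q * q + q * dx q)"
      by (simp add: dx_mult dx_add power2_eq_square)
    moreover have "dx y = dx (fps_X * (1 + fps_u * y) * q^2)" using y by (simp add: q_def)
    ultimately have "dx y = fps_X * (fps_u * dx y) * q^2 + fps_X * (1 + fps_u * y) * (dx q * q + q * dx q)"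
      by simp
    then have "dx y = fps_X * (fps_u * (1 + y^2)^2 + (1 + fps_u * y) * 4 * y * (1 + y^2)) * dx y"
      unfolding dq unfolding q_def by algebra
    then have "(1 - fps_X * (fps_u * (1 + y^2)^2 + (1 + fps_u * y) * 4 * y * (1 + y^2))) * dx y = 0"
      by algebra
    moreover have "1 - fps_X * (fps_u * (1 + y^2)^2 + (1 + fps_u * y) * 4 * y * (1 + y^2)) \<noteq> 0"
      (is "?c \<noteq> 0")
    proof
      assume "?c = 0"
      then have "fps_nth ?c 0 = 0" by simp
      then show False by simp
    qed
    ultimately show ?thesis by simp
  qed
  define x where "x = 1 + y^2"
  define \<delta> where "\<delta> = W\<^sub>1 - p * (1 - y^2 - fps_u * y^3)"
  define w where "w = subst_x x W"
  \<comment> \<open>The derivative is taken before x is replaced by 1 + y^2.\<close>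
  define w' where "w' = subst_x x (dx W)"
  have v: "fps_X * W\<^sub>1 = y * (1 - y^2 - fps_u * y^3) + fps_X * \<delta>"
    unfolding \<delta>_def using yp by algebra
  note hom = subst_x_add subst_x_diff subst_x_mult subst_x_free_x[OF dx_W\<^sub>1]
  have eq: "(x - 1) * (w - 1) = fps_X * x * w * (fps_u * (x - 1) + fps_X * (x * w - W\<^sub>1))"
    using arg_cong[OF W_functional_equation, of "subst_x x"] by (simp add: hom w_def)
  have dx_lhs: "dx ((fps_x - 1) * (W - 1)) = (W - 1) + (fps_x - 1) * dx W"
    by (simp add: dx_mult dx_diff)
  have dx_rhs: "dx (fps_X * fps_x * W * (fps_u * (fps_x - 1) + fps_X * (fps_x * W - W\<^sub>1))) =
      (fps_X * W + fps_X * fps_x * dx W) * (fps_u * (fps_x - 1) + fps_X * (fps_x * W - W\<^sub>1))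
      + fps_X * fps_x * W * (fps_u + fps_X * (W + fps_x * dx W))"
    by (simp add: dx_mult dx_add dx_diff)
  from arg_cong[OF W_functional_equation, of dx]
  have "(W - 1) + (fps_x - 1) * dx W =
      fps_X * (W + fps_x * dx W) * (fps_u * (fps_x - 1) + fps_X * (fps_x * W - W\<^sub>1))
      + fps_X * fps_x * W * (fps_u + fps_X * (W + fps_x * dx W))"
    unfolding dx_lhs dx_rhs by algebra
  from arg_cong[OF this, of "subst_x x"]
  have eq': "(w - 1) + (x - 1) * w' =
      fps_X * (w + x * w') * (fps_u * (x - 1) + fps_X * (x * w - W\<^sub>1))
      + fps_X * x * w * (fps_u + fps_X * (w + x * w'))"
    by (simp add: hom w_def w'_def)
  define M where "M = 2 * fps_X^2 * x^2 * w + ((x - 1) * (fps_X * x * fps_u - 1) - fps_X^2 * x * W\<^sub>1)"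
  define M' where "M' = 4 * fps_X^2 * x * w + 2 * fps_X^2 * x^2 * w'
    + ((fps_X * x * fps_u - 1) + (x - 1) * fps_X * fps_u - fps_X^2 * W\<^sub>1)"
  note root = double_root[OF eq[unfolded x_def] eq'[unfolded x_def] y v, folded x_def, folded M_def M'_def]
  obtain e where e: "M * M' = fps_X^2 * \<delta> * e" using root(2) by blast
  have "\<delta> = 0"
  proof (rule ccontr)
    assume "\<delta> \<noteq> 0"
    \<comment> \<open>Since y = t p, both expressions for the square contain t^4 \<delta>. After
      cancellation the constant terms are 0 on the left and 4 on the right.\<close>
    have "fps_X^4 * \<delta> * (\<delta> * e^2) = (M * M')^2" unfolding e by algebra
    also have "\<dots> = fps_X^3 * x^2 * \<delta> * (4 * y + fps_X * \<delta>) * M'^2"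
      unfolding power_mult_distrib root(1) ..
    also have "\<dots> = fps_X^4 * \<delta> * (x^2 * (4 * p + \<delta>) * M'^2)"
      by (subst yp) algebra
    finally have "\<delta> * e^2 = x^2 * (4 * p + \<delta>) * M'^2" using \<open>\<delta> \<noteq> 0\<close> by simp
    then have "fps_nth (\<delta> * e^2) 0 = fps_nth (x^2 * (4 * p + \<delta>) * M'^2) 0" by simp
    moreover have "fps_nth \<delta> 0 = 0"
      by (simp add: \<delta>_def W\<^sub>1_def b_coeff_def sync_pairs_0 p0 y0 power2_eq_square power3_eq_cube)
    moreover have "fps_nth x 0 = 1" by (simp add: x_def y0 power2_eq_square)
    moreover have "fps_nth M' 0 = -1" by (simp add: M'_def power2_eq_square)
    ultimately show False by (simp add: p0 power2_eq_square)
  qed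
  then show ?thesis using v by simp
qed

text \<open>
  The quintic is the resultant of the two hypotheses with respect to \<open>y\<close>, divided by \<open>u\<^sup>3\<close>.
\<close>

lemma boundary_series_quintic:
  fixes t u y z :: "'a :: idom"
  assumes y: "y = t * (1 + u * y) * (1 + y^2)^2" and z: "z = y * (1 - y^2 - u * y^3)"
  shows "t^4 * u * z^5
    + (4 * t^4 * u^2 + t^4 + 4 * t^3 * u) * z^4
    + (6 * t^4 * u^3 + 12 * t^4 * u + 4 * t^3 * u^2 + 3 * t^3 + 6 * t^2 * u) * z^3
    + (4 * t^4 * u^4 + 22 * t^4 * u^2 + 8 * t^4 - 4 * t^3 * u^3 - 13 * t^3 * u - 4 * t^2 * u^2
       + 3 * t^2 + 4 * t * u) * z^2
    + (t^4 * u^5 + 12 * t^4 * u^3 + 32 * t^4 * u - 4 * t^3 * u^4 + 13 * t^3 * u^2 - 20 * t^3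
       + 6 * t^2 * u^3 - 26 * t^2 * u - 4 * t * u^2 + t + u) * z
    + (t^4 * u^4 + 8 * t^4 * u^2 + 16 * t^4 - 3 * t^3 * u^3 + 20 * t^3 * u + 3 * t^2 * u^2
       - t^2 - t * u) = 0" (is "?P = 0")
  using assms by algebra

section \<open>Algebraicity\<close>

abbreviation (input) emb :: "rat poly poly fps \<Rightarrow> rat poly poly fps fract" where
  "emb f \<equiv> Fract f 1"

lemma emb_simps:
  "emb (f + g) = emb f + emb g" "emb (f - g) = emb f - emb g" "emb (f * g) = emb f * emb g"
  "emb (f ^ n) = emb f ^ n"
proof -
  show mult: "emb (f * g) = emb f * emb g" for f g by simp
  show "emb (f ^ n) = emb f ^ n"
    by (induction n) (simp_all add: mult fract_collapse flip: One_fract_def)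
qed simp_all

section \<open>Rational functions and polynomials over them\<close>

lemma rational_functions_add:
  assumes "a \<in> rational_functions" "b \<in> rational_functions"
  shows "a + b \<in> rational_functions"
proof -
  obtain p q p' q' where "a = Fract (fps_of_poly p) (fps_of_poly q)" "q \<noteq> 0"
    "b = Fract (fps_of_poly p') (fps_of_poly q')" "q' \<noteq> 0"
    using assms by (auto simp: rational_functions_def)
  then have "a + b = Fract (fps_of_poly (p * q' + p' * q)) (fps_of_poly (q * q'))" "q * q' \<noteq> 0"
    by (simp_all add: fps_of_poly_add fps_of_poly_mult)
  then show ?thesis unfolding rational_functions_def by blast
qed

lemma rational_functions_mult:
  assumes "a \<in> rational_functions" "b \<in> rational_functions"
  shows "a * b \<in> rational_functions"
proof -
  obtain p q p' q' where "a = Fract (fps_of_poly p) (fps_of_poly q)" "q \<noteq> 0"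
    "b = Fract (fps_of_poly p') (fps_of_poly q')" "q' \<noteq> 0"
    using assms by (auto simp: rational_functions_def)
  then have "a * b = Fract (fps_of_poly (p * p')) (fps_of_poly (q * q'))" "q * q' \<noteq> 0"
    by (simp_all add: fps_of_poly_mult)
  then show ?thesis unfolding rational_functions_def by blast
qed

lemma rational_functions_emb_poly: "emb (fps_of_poly p) \<in> rational_functions"
proof -
  have "emb (fps_of_poly p) = Fract (fps_of_poly p) (fps_of_poly 1)" by simp
  then show ?thesis
    unfolding rational_functions_def mem_Collect_eq by (intro exI[of _ p] exI[of _ 1]) simp
qed

definition rational_poly :: "rat poly poly fps fract poly \<Rightarrow> bool" where
  "rational_poly P \<longleftrightarrow> (\<forall>i. coeff P i \<in> rational_functions)"

lemma rational_functions_0: "0 \<in> rational_functions"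
  using rational_functions_emb_poly[of 0] by (simp add: fract_collapse)

lemma rational_poly_const:
  assumes "c \<in> rational_functions"
  shows "rational_poly [:c:]"
  using assms rational_functions_0 by (auto simp: rational_poly_def coeff_pCons split: nat.split)

lemma rational_poly_add: "rational_poly P \<Longrightarrow> rational_poly Q \<Longrightarrow> rational_poly (P + Q)"
  by (auto simp: rational_poly_def intro: rational_functions_add)

lemma rational_poly_mult:
  assumes "rational_poly P" "rational_poly Q"
  shows "rational_poly (P * Q)"
proof -
  have "(\<Sum>i\<in>A. coeff P i * coeff Q (n - i)) \<in> rational_functions" for A n
    using assms by (induction A rule: infinite_finite_induct)
      (auto simp: rational_poly_def intro: rational_functions_0 rational_functions_add rational_functions_mult)
  then show ?thesis by (simp add: rational_poly_def coeff_mult)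
qed

lemma rational_poly_power: "rational_poly P \<Longrightarrow> rational_poly (P ^ n)"
  using rational_poly_const[OF rational_functions_emb_poly[of 1]]
  by (induction n) (auto simp: fract_collapse one_pCons[symmetric] intro: rational_poly_mult)

lemma rational_poly_sum: "(\<And>i. i \<in> A \<Longrightarrow> rational_poly (f i)) \<Longrightarrow> rational_poly (sum f A)"
  using rational_poly_const[OF rational_functions_0]
  by (induction A rule: infinite_finite_induct) (simp_all add: rational_poly_add)

lemma W\<^sub>1_algebraic:
  "\<exists>a. a 5 = [:0, 1:]^4 * [:var_u:] \<and> (\<Sum>i\<le>5. fps_of_poly (a i) * (fps_X * W\<^sub>1) ^ i) = 0"
proof -
  obtain y :: "rat poly poly fps" where y: "y = fps_X * (1 + fps_u * y) * (1 + y^2)^2"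
    using Y_exists by blast
  define z where "z = fps_X * W\<^sub>1"
  define t where "t = ([:0, 1:] :: rat poly poly poly)"
  define u where "u = [:var_u:]"
  have tu: "fps_of_poly t = fps_X" "fps_of_poly u = fps_u"
    by (simp_all add: t_def u_def fps_of_poly_fps_X fps_of_poly_const)
  define a where "a = (\<lambda>i :: nat. [t^4 * u^4 + 8 * t^4 * u^2 + 16 * t^4 - 3 * t^3 * u^3 + 20 * t^3 * u
       + 3 * t^2 * u^2 - t^2 - t * u,
     t^4 * u^5 + 12 * t^4 * u^3 + 32 * t^4 * u - 4 * t^3 * u^4 + 13 * t^3 * u^2 - 20 * t^3
       + 6 * t^2 * u^3 - 26 * t^2 * u - 4 * t * u^2 + t + u,
     4 * t^4 * u^4 + 22 * t^4 * u^2 + 8 * t^4 - 4 * t^3 * u^3 - 13 * t^3 * u - 4 * t^2 * u^2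
       + 3 * t^2 + 4 * t * u,
     6 * t^4 * u^3 + 12 * t^4 * u + 4 * t^3 * u^2 + 3 * t^3 + 6 * t^2 * u,
     4 * t^4 * u^2 + t^4 + 4 * t^3 * u,
     t^4 * u] ! i)"
  have "(\<Sum>i\<le>5. fps_of_poly (a i) * z ^ i) = 0"
    using boundary_series_quintic[OF y, of z] W\<^sub>1_eq[OF y]
    by (simp add: a_def z_def[symmetric] eval_nat_numeral(2,3) atMost_Suc fps_of_poly_add fps_of_poly_diff
      fps_of_poly_mult fps_of_poly_power tu fps_of_poly_numeral power_Suc add_ac del: power_Suc)
  moreover have "a 5 = t^4 * u" by (simp add: a_def)
  ultimately show ?thesis unfolding t_def u_def z_def by blast
qed

theorem mainTheorem5:
  shows "algebraic_over rational_functions (Fract F_circ 1)"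
proof -
  let ?t = "emb fps_X" and ?u = "emb fps_u" and ?x = "emb fps_x" and ?F = "emb F_circ"
  obtain a where a5: "a 5 = [:0, 1:]^4 * [:var_u:]"
    and a: "(\<Sum>i\<le>5. fps_of_poly (a i) * (fps_X * W\<^sub>1) ^ i) = 0"
    using W\<^sub>1_algebraic by blast
  \<comment> \<open>Solving the functional equation for t W1 gives the quotient of
    \<open>num\<close> by \<open>den\<close>.\<close>
  define num where "num = fps_X * fps_x * fps_u * (fps_x - 1) * W + fps_X^2 * fps_x^2 * W^2
    - (fps_x - 1) * (W - 1)"
  define den where "den = fps_X * fps_x * W"
  have num_eq: "num = (fps_X * W\<^sub>1) * den"
    unfolding num_def den_def using W_functional_equation by algebra
  \<comment> \<open>\<open>V\<close>, \<open>numP\<close> and \<open>denP\<close> are W,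
    \<open>num\<close> and \<open>den\<close> with \<open>F_circ\<close> replaced by the polynomial
    variable. \<open>P\<close> is the quintic at the quotient of \<open>numP\<close> by
    \<open>denP\<close>, multiplied by \<open>denP ^ 5\<close>.\<close>
  define V where "V = [:1, 1 :: rat poly poly fps fract:]"
  define numP where "numP = [:?t * ?x * ?u * (?x - 1):] * V + [:?t^2 * ?x^2:] * V^2
    + [:1 - ?x:] * [:0, 1:]"
  define denP where "denP = [:?t * ?x:] * V"
  define P where "P = (\<Sum>i\<le>5. [:emb (fps_of_poly (a i)):] * (numP ^ i * denP ^ (5 - i)))"
  have one: "emb 1 = 1" by (simp add: One_fract_def)
  have V: "poly V ?F = emb W" unfolding V_def W_eq emb_simps(1) one by simp
  have zero: "emb 0 = 0" by (simp add: fract_collapse)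
  have F: "?F = emb W - 1" unfolding W_eq emb_simps one by simp
  note poly_simps = poly_sum poly_add poly_mult poly_power poly_pCons poly_0 mult_zero_right add_0_right
  have numP: "poly numP ?F = emb num"
    unfolding numP_def num_def emb_simps one poly_simps V unfolding F by algebra
  have denP: "poly denP ?F = emb den"
    unfolding denP_def den_def emb_simps poly_simps V ..
  have emb_sum: "emb (\<Sum>i\<in>A. f i) = (\<Sum>i\<in>A. emb (f i))" for A :: "nat set" and f
    by (induction A rule: infinite_finite_induct)
      (simp_all only: sum.empty sum.insert sum.infinite emb_simps zero not_False_eq_True)
  have "poly P ?F = emb (\<Sum>i\<le>5. fps_of_poly (a i) * (num ^ i * den ^ (5 - i)))"
    unfolding P_def poly_simps numP denP emb_sum emb_simps ..
  also have "(\<Sum>i\<le>5. fps_of_poly (a i) * (num ^ i * den ^ (5 - i)))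
      = (\<Sum>i\<le>5. fps_of_poly (a i) * (fps_X * W\<^sub>1) ^ i) * den ^ 5"
    unfolding sum_distrib_right
  proof (rule sum.cong[OF refl])
    fix i :: nat assume "i \<in> {..5}"
    then have "den ^ 5 = den ^ i * den ^ (5 - i)" by (simp flip: power_add)
    then show "fps_of_poly (a i) * (num ^ i * den ^ (5 - i))
        = fps_of_poly (a i) * (fps_X * W\<^sub>1) ^ i * den ^ 5"
      by (simp add: num_eq power_mult_distrib mult_ac)
  qed
  finally have root: "poly P ?F = 0" unfolding a mult_zero_left zero .
  \<comment> \<open>The point -1 corresponds to W = 0. There \<open>denP\<close> vanishes, so only
    the leading coefficient survives, multiplied by (x - 1)^5.\<close>
  have "poly P (-1) \<noteq> 0"
  proof -
    have at: "poly numP (-1) = ?x - 1" "poly denP (-1) = 0"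
      by (simp_all add: numP_def denP_def V_def zero)
    have "poly P (-1) = (\<Sum>i\<in>{5}. emb (fps_of_poly (a i)) * ((?x - 1) ^ i * 0 ^ (5 - i)))"
      unfolding P_def poly_sum poly_mult poly_power at
      by (rule sum.mono_neutral_cong_right) auto
    also have "\<dots> = emb (fps_of_poly (a 5)) * (?x - 1) ^ 5" by simp
    also have "\<dots> = emb (fps_of_poly (a 5) * (fps_x - 1) ^ 5)" by (simp only: emb_simps one)
    finally have *: "poly P (-1) = emb (fps_of_poly (a 5) * (fps_x - 1) ^ 5)" .
    have "a 5 \<noteq> 0" by (simp add: a5 var_u_def)
    moreover have "fps_x \<noteq> 1"
      by (simp add: var_x_def one_pCons flip: fps_const_1_eq_1)
    ultimately show ?thesis unfolding * by (simp add: Zero_fract_def eq_fract)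
  qed
  then have "P \<noteq> 0" by auto
  have mem: "?t \<in> rational_functions" "?u \<in> rational_functions" "?x \<in> rational_functions"
    "?x - 1 \<in> rational_functions" "1 - ?x \<in> rational_functions" "1 \<in> rational_functions"
    using rational_functions_emb_poly[of "[:0, 1:]"] rational_functions_emb_poly[of "[:var_u:]"]
      rational_functions_emb_poly[of "[:var_x:]"] rational_functions_emb_poly[of "[:var_x:] - 1"]
      rational_functions_emb_poly[of "1 - [:var_x:]"] rational_functions_emb_poly[of 1]
    by (simp_all only: fps_of_poly_fps_X fps_of_poly_const fps_of_poly_diff fps_of_poly_1 emb_simps one)
  note closed = rational_poly_add rational_poly_mult rational_poly_power rational_poly_const
    rational_functions_mult rational_functions_emb_poly mem
  have X: "rational_poly [:0, 1:]"
    using mem rational_functions_0 by (auto simp: rational_poly_def coeff_pCons split: nat.split)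
  have "rational_poly ([:1:] + [:0, 1:])" by (intro closed X)
  then have "rational_poly V" by (simp add: V_def)
  then have "rational_poly P"
    unfolding P_def numP_def denP_def power2_eq_square
    by (intro rational_poly_sum closed X)
  then show ?thesis
    unfolding algebraic_over_def rational_poly_def using root \<open>P \<noteq> 0\<close> by blast
qed

end
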